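(* Let $d$ and $N$ be positive integers with $N \geq 2$, and let $(c_1, c_2, c_3, \dots)$ be a nonincreasing sequence of numbers in $[0,1]$. Then there exists a strictly stationary random field $X := (X_k, k \in \mathbf{Z}^d)$ of real-valued random variables with the following properties: (A) $X_{\mathbf{0}}$ is uniformly distributed on $[0,1]$ (where $\mathbf{0}=(0,\dots,0)$); (B) $X$ satisfies $N$-tuplewise independence; (C) for every positive integer $n$, $4\alpha(X,n) = \rho(X,n) = \rho'(X,n) = \rho^*(X,n) = c_n$.
   Context: All random variables are defined on a common probability space $(\Omega,\mathcal{F},P)$. For $k\in\mathbf{Z}^d$, $k=(k_1,\dots,k_d)$ and $\|k\|$ is the Euclidean norm; for nonempty disjoint $S,T\subset\mathbf{Z}^d$, $\mathrm{dist}(S,T)=\min_{s\in S,t\in T}\|s-t\|$ (and for subsets of $\mathbf{Z}$, $\mathrm{dist}(G,H)=\min_{g\in G,h\in H}|g-h|$). For a collection of random variables, $\sigma(\cdot)$ denotes the generated $\sigma$-field. A random field $X=(X_k,k\in\mathbf{Z}^d)$ satisfies $N$-tuplewise independence if for every choice of $N$ distinct $k(1),\dots,k(N)\in\mathbf{Z}^d$ the random variables $X_{k(1)},\dots,X_{k(N)}$ are independent. For $\sigma$-fields $\mathcal{A},\mathcal{B}\subset\mathcal{F}$: $\alpha(\mathcal{A},\mathcal{B}) := \sup_{A\in\mathcal{A},B\in\mathcal{B}}|P(A\cap B)-P(A)P(B)|$ and $\rho(\mathcal{A},\mathcal{B}) := \sup|\mathrm{Corr}(f,g)|$ over all square-integrable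 $f$ that are $\mathcal{A}$-measurable and $g$ that are $\mathcal{B}$-measurable. For a random field $X$ and $n\in\mathbf{N}$: $\alpha(X,n)$ (resp. $\rho(X,n)$) is the supremum of $\alpha$ (resp. $\rho$) of $(\sigma(X_k,k\in S),\sigma(X_k,k\in T))$ over all pairs $S=\{k\in\mathbf{Z}^d:k_u\le j\}$, $T=\{k\in\mathbf{Z}^d:k_u\ge j+n\}$ with $j\in\mathbf{Z}$, $u\in\{1,\dots,d\}$; $\rho'(X,n)$ is the supremum of $\rho(\sigma(X_k,k\in S),\sigma(X_k,k\in T))$ over all $S=\{k:k_u\in G\}$, $T=\{k:k_u\in H\}$ with $u\in\{1,\dots,d\}$ and $G,H\subset\mathbf{Z}$ nonempty, disjoint, $\mathrm{dist}(G,H)\ge n$; $\rho^*(X,n)$ is the supremum of $\rho(\sigma(X_k,k\in S),\sigma(X_k,k\in T))$ over all nonempty disjoint $S,T\subset\mathbf{Z}^d$ with $\mathrm{dist}(S,T)\ge n$. *)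

theory Defs
  imports "HOL-Probability.Probability"
begin

text \<open>Points of Z^d are vectors int^'d (the dimension d = CARD('d) is a finite type).\<close>

definition zd_norm :: "int ^ 'd::finite \<Rightarrow> real" where
  "zd_norm k = sqrt (\<Sum>u\<in>UNIV. (real_of_int (k $ u))^2)"

definition gen_sigma :: "'a measure \<Rightarrow> ('i \<Rightarrow> 'a \<Rightarrow> real) \<Rightarrow> 'i set \<Rightarrow> 'a set set" where
  "gen_sigma M X S =
     sigma_sets (space M) (\<Union>k\<in>S. {X k -` B \<inter> space M | B. B \<in> sets borel})"

definition alpha_coef :: "'a measure \<Rightarrow> 'a set set \<Rightarrow> 'a set set \<Rightarrow> real" where
  "alpha_coef M A B =
     Sup {\<bar>measure M (a \<inter> b) - measure M a * measure M b\<bar> | a b. a \<in> A \<and> b \<in> B}"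

definition covar :: "'a measure \<Rightarrow> ('a \<Rightarrow> real) \<Rightarrow> ('a \<Rightarrow> real) \<Rightarrow> real" where
  "covar M f g = (\<integral>x. f x * g x \<partial>M) - (\<integral>x. f x \<partial>M) * (\<integral>x. g x \<partial>M)"

text \<open>Correlation; by the Isabelle convention x / 0 = 0 it is 0 when a variance vanishes.\<close>
definition corr :: "'a measure \<Rightarrow> ('a \<Rightarrow> real) \<Rightarrow> ('a \<Rightarrow> real) \<Rightarrow> real" where
  "corr M f g = covar M f g / (sqrt (covar M f f) * sqrt (covar M g g))"

definition rho_coef :: "'a measure \<Rightarrow> 'a set set \<Rightarrow> 'a set set \<Rightarrow> real" where
  "rho_coef M A B =
     Sup {\<bar>corr M f g\<bar> | f g.
            f \<in> borel_measurable (sigma (space M) A) \<and> g \<in> borel_measurable (sigma (space M) B) \<and>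
            integrable M (\<lambda>x. (f x)^2) \<and> integrable M (\<lambda>x. (g x)^2)}"

definition alpha_field :: "'a measure \<Rightarrow> (int ^ 'd::finite \<Rightarrow> 'a \<Rightarrow> real) \<Rightarrow> nat \<Rightarrow> real" where
  "alpha_field M X n =
     Sup {alpha_coef M (gen_sigma M X {k. k $ u \<le> j}) (gen_sigma M X {k. k $ u \<ge> j + int n})
          | j u. True}"

definition rho_field :: "'a measure \<Rightarrow> (int ^ 'd::finite \<Rightarrow> 'a \<Rightarrow> real) \<Rightarrow> nat \<Rightarrow> real" where
  "rho_field M X n =
     Sup {rho_coef M (gen_sigma M X {k. k $ u \<le> j}) (gen_sigma M X {k. k $ u \<ge> j + int n})
          | j u. True}"

definition rho'_field :: "'a measure \<Rightarrow> (int ^ 'd::finite \<Rightarrow> 'a \<Rightarrow> real) \<Rightarrow> nat \<Rightarrow> real" where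
  "rho'_field M X n =
     Sup {rho_coef M (gen_sigma M X {k. k $ u \<in> G}) (gen_sigma M X {k. k $ u \<in> H})
          | u G H. G \<noteq> {} \<and> H \<noteq> {} \<and> G \<inter> H = {} \<and>
                   (\<forall>g\<in>G. \<forall>h\<in>H. int n \<le> \<bar>g - h\<bar>)}"

definition rho_star_field :: "'a measure \<Rightarrow> (int ^ 'd::finite \<Rightarrow> 'a \<Rightarrow> real) \<Rightarrow> nat \<Rightarrow> real" where
  "rho_star_field M X n =
     Sup {rho_coef M (gen_sigma M X S) (gen_sigma M X T)
          | S T. S \<noteq> {} \<and> T \<noteq> {} \<and> S \<inter> T = {} \<and>
                 (\<forall>s\<in>S. \<forall>t\<in>T. real n \<le> zd_norm (s - t))}"

definition strictly_stationary :: "'a measure \<Rightarrow> (int ^ 'd::finite \<Rightarrow> 'a \<Rightarrow> real) \<Rightarrow> bool" where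
  "strictly_stationary M X \<longleftrightarrow>
     (\<forall>h S. finite S \<longrightarrow>
        distr M (PiM S (\<lambda>_. borel)) (\<lambda>\<omega>. \<lambda>k\<in>S. X (k + h) \<omega>) =
        distr M (PiM S (\<lambda>_. borel)) (\<lambda>\<omega>. \<lambda>k\<in>S. X k \<omega>))"

definition tuplewise_indep :: "'a measure \<Rightarrow> nat \<Rightarrow> ('i \<Rightarrow> 'a \<Rightarrow> real) \<Rightarrow> bool" where
  "tuplewise_indep M N X \<longleftrightarrow>
     (\<forall>S. finite S \<and> card S = N \<longrightarrow> prob_space.indep_vars M (\<lambda>_. borel) X S)"

end

theory Submission
  imports Defs
begin

text \<open>Take independent blocks indexed by \<open>m \<ge> 0\<close> and \<open>k \<in> Z^d\<close>. A block consists of \<open>N + 1\<close> signs with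
  density \<open>1 + c\<^sub>m\<^sub>+\<^sub>1 \<cdot> (product of the signs)\<close> with respect to fair coin tossing, placed along a line at the
  sites \<open>k, k + (m+1)e, \<dots>, k + N(m+1)e\<close>. Any \<open>N\<close> signs of a block are independent and fair, while the
  maximal correlation of a partition of the block into two parts is exactly \<open>c\<^sub>m\<^sub>+\<^sub>1\<close>; two sets at
  distance greater than \<open>m + 1\<close> that both meet the block cannot cover it, hence see independent parts. Each site
  encodes its countably many fair signs as the binary digits of one uniform variable. Maximal correlation
  tensorises over independent blocks, so at distance \<open>n\<close> it is at most \<open>sup {c\<^sub>m | m \<ge> n} = c\<^sub>n\<close>, and
  the parities of the two parts of a block with \<open>m + 1 = n\<close> attain this bound already for
  half-spaces and events, which gives all four coefficients.\<close>

subsection \<open>Tensorisation of a correlation inequality\<close>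

text \<open>The tilt \<open>1 + c * parity\<close> perturbs fair coin tossing along a single
  character, the product of all signs. Averaging out one sign kills this character, so proper
  subfamilies see nothing of it; across a partition it factors into two parities, so the coupling
  has rank one and strength \<open>c\<close>. A parity is also a two-valued variable of mean zero,
  that is, an affine image of the indicator of an event of probability 1/2, and for such events
  correlation is four times covariance. This is why one construction makes four times \<alpha> agree
  with the \<rho> coefficients, where in general there is only an inequality.

  The line makes the geometry combinatorial: two sets that cover a block must meet it at two
  consecutive sites, so their distance is at most the step. Blocks of all steps can coexist because
  the bounds do not add up: tensorisation keeps the largest single-block bound.

  The binary encoding is not invertible at dyadic rationals. The upper bounds use only that the
  field is a function of the signs, which holds everywhere; the lower bounds recover the signs from
  the field, and almost surely is enough there.\<close>

text \<open>Up to rescaling \<open>f\<close> and \<open>g\<close> this says that their correlation is at most \<open>r\<close>; unlike the version with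
  square roots, it is additive over conditioning.\<close>

definition covar_le :: "'a measure \<Rightarrow> real \<Rightarrow> ('a \<Rightarrow> real) \<Rightarrow> ('a \<Rightarrow> real) \<Rightarrow> bool" where
  "covar_le M r f g \<longleftrightarrow> 2 * covar M f g \<le> r * (covar M f f + covar M g g)"

lemma (in prob_space) integrable_bounded:
  fixes f :: "'a \<Rightarrow> real"
  assumes "f \<in> borel_measurable M" "\<And>x. \<bar>f x\<bar> \<le> K"
  shows "integrable M f"
  by (rule integrable_const_bound[where B=K]) (use assms in auto)

lemma (in prob_space) integrable_bounded_mult:
  fixes f g :: "'a \<Rightarrow> real"
  assumes "f \<in> borel_measurable M" "\<And>x. \<bar>f x\<bar> \<le> K" "g \<in> borel_measurable M" "\<And>x. \<bar>g x\<bar> \<le> L"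
  shows "integrable M (\<lambda>x. f x * g x)"
proof (rule integrable_bounded)
  show "\<bar>f x * g x\<bar> \<le> K * L" for x
    using assms(2)[of x] assms(4)[of x] by (auto simp: abs_mult intro!: mult_mono)
qed (use assms in measurable)

lemma (in prob_space) covar_self_nonneg:
  assumes "integrable M f" "integrable M (\<lambda>x. f x * f x)"
  shows "0 \<le> covar M f f"
proof -
  have "0 \<le> (\<integral>x. (f x - expectation f)\<^sup>2 \<partial>M)" by simp
  also have "\<dots> = (\<integral>x. f x * f x - 2 * expectation f * f x + (expectation f)\<^sup>2 \<partial>M)"
    by (intro Bochner_Integration.integral_cong) (auto simp: power2_eq_square algebra_simps)
  also have "\<dots> = covar M f f"
    using assms by (simp add: covar_def prob_space power2_eq_square)
  finally show ?thesis .
qed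

text \<open>Redrawing coordinate \<open>j\<close> independently leaves the product measure
  invariant, and Fubini turns this into an iterated integral. The inner integral acts as conditional
  expectation given the other coordinates, without splitting the function space into a
  product.\<close>

lemma PiM_resample:
  fixes p :: "'i \<Rightarrow> 'b pmf" and h :: "('i \<Rightarrow> 'b) \<Rightarrow> real"
  defines "P \<equiv> PiM UNIV (\<lambda>i. measure_pmf (p i))"
  assumes [measurable]: "h \<in> borel_measurable P" and bd: "\<And>w. \<bar>h w\<bar> \<le> K"
  shows "(\<integral>w. h w \<partial>P) = (\<integral>w. (\<integral>x. h (w(j := x)) \<partial>measure_pmf (p j)) \<partial>P)"
    and "(\<lambda>w. \<integral>x. h (w(j := x)) \<partial>measure_pmf (p j)) \<in> borel_measurable P"
    and "\<bar>\<integral>x. h (w(j := x)) \<partial>measure_pmf (p j)\<bar> \<le> K"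
proof -
  interpret P: prob_space P
    unfolding P_def by (intro prob_space_PiM prob_space_measure_pmf)
  interpret PP: pair_prob_space "measure_pmf (p j)" P ..
  have upd[measurable]: "(\<lambda>(x, w). w(j := x)) \<in> measure_pmf (p j) \<Otimes>\<^sub>M P \<rightarrow>\<^sub>M P"
    unfolding P_def using measurable_fun_upd[of UNIV UNIV j snd "measure_pmf (p j) \<Otimes>\<^sub>M P" "\<lambda>i. measure_pmf (p i)" fst]
    by (auto simp: split_beta' P_def)
  have d: "distr (measure_pmf (p j) \<Otimes>\<^sub>M P) P (\<lambda>(x, w). w(j := x)) = P"
    using distr_pair_PiM_eq_PiM[of UNIV "\<lambda>i. measure_pmf (p i)" j]
    by (simp add: P_def prob_space_measure_pmf)
  have m: "(\<lambda>(x, w). h (w(j := x))) \<in> borel_measurable (measure_pmf (p j) \<Otimes>\<^sub>M P)"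
    using measurable_compose[OF upd assms(2)] by (simp add: split_beta')
  have i: "integrable (measure_pmf (p j) \<Otimes>\<^sub>M P) (\<lambda>(x, w). h (w(j := x)))"
    by (rule PP.P.integrable_bounded[OF m, where K=K]) (auto simp: bd)
  have "(\<integral>w. h w \<partial>P) = (\<integral>z. h ((\<lambda>(x, w). w(j := x)) z) \<partial>(measure_pmf (p j) \<Otimes>\<^sub>M P))"
    by (subst d[symmetric], subst integral_distr) (auto)
  also have "\<dots> = (\<integral>w. (\<integral>x. h (w(j := x)) \<partial>measure_pmf (p j)) \<partial>P)"
    using PP.integral_snd[OF i] by (simp add: split_beta')
  finally show "(\<integral>w. h w \<partial>P) = (\<integral>w. (\<integral>x. h (w(j := x)) \<partial>measure_pmf (p j)) \<partial>P)" .
  show "(\<lambda>w. \<integral>x. h (w(j := x)) \<partial>measure_pmf (p j)) \<in> borel_measurable P"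
  proof (rule measure_pmf.borel_measurable_lebesgue_integral)
    show "(\<lambda>(w, x). h (w(j := x))) \<in> borel_measurable (P \<Otimes>\<^sub>M measure_pmf (p j))"
      using measurable_compose[OF measurable_pair_swap' m] by (simp add: split_beta')
  qed
  have "\<bar>\<integral>x. h (w(j := x)) \<partial>measure_pmf (p j)\<bar> \<le> (\<integral>x. \<bar>h (w(j := x))\<bar> \<partial>measure_pmf (p j))"
    by (rule integral_abs_bound)
  also have "\<dots> \<le> (\<integral>x. K \<partial>measure_pmf (p j))"
    using order_trans[OF abs_ge_zero bd]
    by (intro integral_mono measure_pmf.integrable_bounded[where K=K]) (auto simp: bd)
  finally show "\<bar>\<integral>x. h (w(j := x)) \<partial>measure_pmf (p j)\<bar> \<le> K" by simp
qed

text \<open>Resampling one coordinate splits each variance into the mean conditional variance and the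
  variance of the conditional mean; the inequality is additive over this decomposition.\<close>

lemma covar_le_cylinder:
  fixes p :: "'i \<Rightarrow> 'b pmf" and u :: "'i \<Rightarrow> 'b \<Rightarrow> 'c" and v :: "'i \<Rightarrow> 'b \<Rightarrow> 'd"
  defines "P \<equiv> PiM UNIV (\<lambda>i. measure_pmf (p i))"
  assumes block: "\<And>i f g. (\<And>x y. u i x = u i y \<Longrightarrow> f x = f y) \<Longrightarrow>
      (\<And>x y. v i x = v i y \<Longrightarrow> g x = g y) \<Longrightarrow> covar_le (measure_pmf (p i)) r f g"
    and "finite J"
    and "f \<in> borel_measurable P" "\<And>w. \<bar>f w\<bar> \<le> K" "g \<in> borel_measurable P" "\<And>w. \<bar>g w\<bar> \<le> L"
    and "\<And>w w'. (\<And>j. j \<in> J \<Longrightarrow> u j (w j) = u j (w' j)) \<Longrightarrow> f w = f w'"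
    and "\<And>w w'. (\<And>j. j \<in> J \<Longrightarrow> v j (w j) = v j (w' j)) \<Longrightarrow> g w = g w'"
  shows "covar_le P r f g"
  using assms(3-)
proof (induction J arbitrary: f g rule: finite_induct)
  case empty
  interpret P: prob_space P
    unfolding P_def by (intro prob_space_PiM prob_space_measure_pmf)
  have "f = (\<lambda>_. f undefined)" "g = (\<lambda>_. g undefined)"
    using empty.prems(5,6) by (auto simp: fun_eq_iff)
  then obtain a b where "f = (\<lambda>_. a)" "g = (\<lambda>_. b)" by blast
  then show ?case by (simp add: covar_le_def covar_def P.prob_space)
next
  case (insert j J)
  interpret P: prob_space P
    unfolding P_def by (intro prob_space_PiM prob_space_measure_pmf)
  note [measurable] = insert.prems(1,3)
  note fb = insert.prems(2) note gb = insert.prems(4)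
  \<comment> \<open>\<open>E h\<close> is the conditional expectation of \<open>h\<close> given all
    coordinates but \<open>j\<close>; as a function of \<open>w\<close> it ignores
    \<open>w j\<close>.\<close>
  define E where "E h w = (\<integral>x. h (w(j := x)) \<partial>measure_pmf (p j))" for h :: "_ \<Rightarrow> real" and w
  have E_int: "(\<integral>w. h w \<partial>P) = (\<integral>w. E h w \<partial>P)"
    and E_meas: "E h \<in> borel_measurable P" and E_bd: "\<And>w. \<bar>E h w\<bar> \<le> C"
    if "h \<in> borel_measurable P" "\<And>w. \<bar>h w\<bar> \<le> C" for h C
    using PiM_resample[of h p C j] that unfolding E_def[abs_def] P_def by blast+
  note Ef = E_meas[OF insert.prems(1) fb] E_bd[OF insert.prems(1) fb]
  note Eg = E_meas[OF insert.prems(3) gb] E_bd[OF insert.prems(3) gb]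
  have prodb: "\<bar>h w * k w\<bar> \<le> C * D" if "\<And>w. \<bar>h w\<bar> \<le> C" "\<And>w. \<bar>k w\<bar> \<le> D"
    for h k :: "('i \<Rightarrow> 'b) \<Rightarrow> real" and w C D
    using that(1)[of w] that(2)[of w] by (auto simp: abs_mult intro!: mult_mono)
  note iEE = P.integrable_bounded_mult
  have E2: "(\<integral>w. h w * k w \<partial>P) = (\<integral>w. E (\<lambda>w. h w * k w) w \<partial>P)"
    "integrable P (E (\<lambda>w. h w * k w))"
    if "h \<in> borel_measurable P" "\<And>w. \<bar>h w\<bar> \<le> C" "k \<in> borel_measurable P" "\<And>w. \<bar>k w\<bar> \<le> D" for h k C D
  proof -
    note [measurable] = that(1,3)
    have m: "(\<lambda>w. h w * k w) \<in> borel_measurable P" by measurable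
    have b: "\<bar>h w * k w\<bar> \<le> C * D" for w by (rule prodb[OF that(2,4)])
    show "(\<integral>w. h w * k w \<partial>P) = (\<integral>w. E (\<lambda>w. h w * k w) w \<partial>P)"
      by (rule E_int[OF m b])
    show "integrable P (E (\<lambda>w. h w * k w))"
      by (rule P.integrable_bounded[OF E_meas[OF m b] E_bd[OF m b]])
  qed
  \<comment> \<open>With the other coordinates frozen, the sections in coordinate \<open>j\<close>
    depend on it only through \<open>u j\<close> and \<open>v j\<close>, so the block hypothesis
    bounds the conditional covariance pointwise.\<close>
  have pt: "2 * (E (\<lambda>w. f w * g w) w - E f w * E g w) \<le>
      r * ((E (\<lambda>w. f w * f w) w - E f w * E f w) + (E (\<lambda>w. g w * g w) w - E g w * E g w))" for w
  proof -
    have "covar_le (measure_pmf (p j)) r (\<lambda>x. f (w(j := x))) (\<lambda>x. g (w(j := x)))"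
      by (rule block; rule insert.prems(5,6)) auto
    then show ?thesis by (simp add: covar_le_def covar_def E_def)
  qed
  have IH: "covar_le P r (E f) (E g)"
  proof (rule insert.IH)
    show "E f w = E f w'" if "\<And>i. i \<in> J \<Longrightarrow> u i (w i) = u i (w' i)" for w w'
      unfolding E_def using that by (intro Bochner_Integration.integral_cong insert.prems(5)) auto
    show "E g w = E g w'" if "\<And>i. i \<in> J \<Longrightarrow> v i (w i) = v i (w' i)" for w w'
      unfolding E_def using that by (intro Bochner_Integration.integral_cong insert.prems(6)) auto
  qed (use Ef Eg in auto)
  have "(\<integral>w. 2 * (E (\<lambda>w. f w * g w) w - E f w * E g w) \<partial>P) \<le>
     (\<integral>w. r * ((E (\<lambda>w. f w * f w) w - E f w * E f w) + (E (\<lambda>w. g w * g w) w - E g w * E g w)) \<partial>P)"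
    by (intro integral_mono pt integrable_mult_right Bochner_Integration.integrable_diff
        Bochner_Integration.integrable_add E2(2)[OF insert.prems(1) fb insert.prems(3) gb]
        E2(2)[OF insert.prems(1) fb insert.prems(1) fb] E2(2)[OF insert.prems(3) gb insert.prems(3) gb]
        iEE[OF Ef Eg] iEE[OF Ef Ef] iEE[OF Eg Eg])
  then have "2 * ((\<integral>w. f w * g w \<partial>P) - (\<integral>w. E f w * E g w \<partial>P)) \<le>
      r * (((\<integral>w. f w * f w \<partial>P) - (\<integral>w. E f w * E f w \<partial>P)) + ((\<integral>w. g w * g w \<partial>P) - (\<integral>w. E g w * E g w \<partial>P)))"
    by (simp add: E2(2)[OF insert.prems(1) fb insert.prems(3) gb]
        E2(2)[OF insert.prems(1) fb insert.prems(1) fb] E2(2)[OF insert.prems(3) gb insert.prems(3) gb]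
        E2(1)[OF insert.prems(1) fb insert.prems(3) gb]
        E2(1)[OF insert.prems(1) fb insert.prems(1) fb] E2(1)[OF insert.prems(3) gb insert.prems(3) gb]
        iEE[OF Ef Eg] iEE[OF Ef Ef] iEE[OF Eg Eg])
  \<comment> \<open>Law of total covariance: the mean of the conditional covariances plus the
    covariance of the conditional means. The integrals of \<open>E f * E g\<close>,
    \<open>E f * E f\<close> and \<open>E g * E g\<close> cancel when the two inequalities are
    added.\<close>
  with IH show ?case
    unfolding covar_le_def covar_def E_int[OF insert.prems(1) fb] E_int[OF insert.prems(3) gb]
    by (simp add: algebra_simps)
qed

subsection \<open>Passage to generated sigma-algebras\<close>

text \<open>Monotone class argument in L1. The functions approximable by \<open>\<Phi>\<close> form
  a vector space closed under L1 limits; it contains the indicators of an intersection-stable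
  generator, hence by Dynkin those of the generated sigma-algebra, hence all integrable functions
  measurable for it.\<close>

lemma L1_dense_generated:
  fixes M :: "'a measure" and f :: "'a \<Rightarrow> real"
  assumes "prob_space M" and C: "Int_stable C" "C \<subseteq> sets M"
    and int: "\<And>h. \<Phi> h \<Longrightarrow> integrable M h"
    and one: "\<Phi> (\<lambda>_. 1)" and ind: "\<And>A. A \<in> C \<Longrightarrow> \<Phi> (indicat_real A)"
    and add: "\<And>h k. \<Phi> h \<Longrightarrow> \<Phi> k \<Longrightarrow> \<Phi> (\<lambda>x. h x + k x)"
    and scale: "\<And>h a. \<Phi> h \<Longrightarrow> \<Phi> (\<lambda>x. a * h x)"
    and f: "f \<in> borel_measurable (sigma (space M) C)" "integrable M f" and "e > 0"
  shows "\<exists>h. \<Phi> h \<and> (\<integral>x. \<bar>f x - h x\<bar> \<partial>M) < e"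
proof -
  interpret prob_space M by fact
  define H where "H f \<longleftrightarrow> integrable M f \<and> (\<forall>e>0. \<exists>h. \<Phi> h \<and> (\<integral>x. \<bar>f x - h x\<bar> \<partial>M) < e)" for f :: "'a \<Rightarrow> real"
  have H_base: "H h" if "\<Phi> h" for h
    using that int unfolding H_def by (auto intro!: exI[of _ h])
  have H_add: "H (\<lambda>x. f x + g x)" if "H f" "H g" for f g
    unfolding H_def
  proof safe
    show "integrable M (\<lambda>x. f x + g x)" using that by (simp add: H_def)
    fix e :: real assume "e > 0"
    then have "e / 2 > 0" by simp
    with that obtain h k where hk: "\<Phi> h" "(\<integral>x. \<bar>f x - h x\<bar> \<partial>M) < e / 2" "\<Phi> k" "(\<integral>x. \<bar>g x - k x\<bar> \<partial>M) < e / 2"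
      unfolding H_def by meson
    note [simp] = int[OF hk(1)] int[OF hk(3)]
    have [simp]: "integrable M f" "integrable M g" using that by (auto simp: H_def)
    have "(\<integral>x. \<bar>(f x + g x) - (h x + k x)\<bar> \<partial>M) \<le> (\<integral>x. \<bar>f x - h x\<bar> + \<bar>g x - k x\<bar> \<partial>M)"
      by (intro integral_mono) auto
    also have "\<dots> < e" using hk by simp
    finally show "\<exists>h. \<Phi> h \<and> (\<integral>x. \<bar>f x + g x - h x\<bar> \<partial>M) < e"
      using add[OF hk(1,3)] by blast
  qed
  have H_scale: "H (\<lambda>x. a * f x)" if "H f" for f a
    unfolding H_def
  proof safe
    show "integrable M (\<lambda>x. a * f x)" using that by (simp add: H_def)
    fix e :: real assume "e > 0"
    then have "e / (\<bar>a\<bar> + 1) > 0" by simp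
    with that obtain h where h: "\<Phi> h" "(\<integral>x. \<bar>f x - h x\<bar> \<partial>M) < e / (\<bar>a\<bar> + 1)"
      unfolding H_def by meson
    have "(\<integral>x. \<bar>a * f x - a * h x\<bar> \<partial>M) = \<bar>a\<bar> * (\<integral>x. \<bar>f x - h x\<bar> \<partial>M)"
      by (subst integral_mult_right_zero[symmetric]) (auto simp: abs_mult[symmetric] right_diff_distrib)
    also have "\<dots> \<le> (\<bar>a\<bar> + 1) * (\<integral>x. \<bar>f x - h x\<bar> \<partial>M)"
      by (intro mult_right_mono) auto
    also have "\<dots> < e" using h(2) by (simp add: field_simps)
    finally show "\<exists>h. \<Phi> h \<and> (\<integral>x. \<bar>a * f x - h x\<bar> \<partial>M) < e"
      using scale[OF h(1), of a] by blast
  qed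
  have H_lim: "H f" if "integrable M f" "\<And>e. e > 0 \<Longrightarrow> \<exists>g. H g \<and> (\<integral>x. \<bar>f x - g x\<bar> \<partial>M) < e" for f
    unfolding H_def
  proof safe
    fix e :: real assume "e > 0"
    then have e: "e / 2 > 0" by simp
    from that(2)[OF this] obtain g where g: "H g" "(\<integral>x. \<bar>f x - g x\<bar> \<partial>M) < e / 2" by blast
    then obtain h where h: "\<Phi> h" "(\<integral>x. \<bar>g x - h x\<bar> \<partial>M) < e / 2"
      unfolding H_def using e by meson
    have [simp]: "integrable M f" "integrable M g" "integrable M h"
      using that(1) g int[OF h(1)] by (auto simp: H_def)
    have "(\<integral>x. \<bar>f x - h x\<bar> \<partial>M) \<le> (\<integral>x. \<bar>f x - g x\<bar> + \<bar>g x - h x\<bar> \<partial>M)"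
      by (intro integral_mono) auto
    also have "\<dots> < e" using g h by simp
    finally show "\<exists>h. \<Phi> h \<and> (\<integral>x. \<bar>f x - h x\<bar> \<partial>M) < e" using h(1) by blast
  qed (rule that)
  \<comment> \<open>Changing a function off \<open>space M\<close> costs nothing in L1, so closure
    under limits applies with error zero.\<close>
  have H_cong: "H g" if "H f" "\<And>x. x \<in> space M \<Longrightarrow> g x = f x" for f g
  proof (rule H_lim)
    show "integrable M g" using that Bochner_Integration.integrable_cong[of M M g f] by (auto simp: H_def)
    show "\<exists>h. H h \<and> (\<integral>x. \<bar>g x - h x\<bar> \<partial>M) < e" if "e > 0" for e :: real
    proof (intro exI conjI)
      have "(\<integral>x. \<bar>g x - f x\<bar> \<partial>M) = (\<integral>x. 0 \<partial>M)"
        using \<open>\<And>x. x \<in> space M \<Longrightarrow> g x = f x\<close> by (intro Bochner_Integration.integral_cong) auto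
      then show "(\<integral>x. \<bar>g x - f x\<bar> \<partial>M) < e" using that by simp
    qed fact
  qed
  have sub: "sigma_sets (space M) C \<subseteq> sets M" using C(2) by (rule sets.sigma_sets_subset)
  have CP: "C \<subseteq> Pow (space M)" using C(2) sets.space_closed by blast
  have H_ind: "H (indicat_real A)" if "A \<in> sigma_sets (space M) C" for A
    using C(1) CP that
  proof (induction rule: sigma_sets_induct_disjoint)
    case (basic A) then show ?case by (intro H_base ind)
  next
    case empty
    show ?case by (rule H_cong[OF H_scale[OF H_base[OF one], of 0]]) simp
  next
    case (compl A)
    show ?case
      by (rule H_cong[OF H_add[OF H_base[OF one] H_scale[OF compl(2), of "-1"]]])
         (auto simp: indicator_def)
  next
    case (union A)
    have [measurable]: "A i \<in> sets M" for i using union(2) sub by blast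
    have fin: "H (indicat_real (\<Union>i<n. A i))" for n
    proof (induction n)
      case 0
      show ?case by (rule H_cong[OF H_scale[OF H_base[OF one], of 0]]) simp
    next
      case (Suc n)
      show ?case
      proof (rule H_cong[OF H_add[OF Suc union(3)[of n]]])
        fix x
        have "A n \<inter> A i = {}" if "i < n" for i
          using disjoint_family_onD[OF union(1), of n i] that by simp
        then have "A n \<inter> (\<Union>i<n. A i) = {}" by blast
        moreover have "(\<Union>i<Suc n. A i) = (\<Union>i<n. A i) \<union> A n" by (auto simp: less_Suc_eq)
        ultimately show "indicat_real (\<Union>i<Suc n. A i) x = indicat_real (\<Union>i<n. A i) x + indicat_real (A n) x"
          by (auto simp: indicator_def)
      qed
    qed
    have lim: "(\<lambda>n. prob (\<Union>i<n. A i)) \<longlonglongrightarrow> prob (\<Union>i. A i)"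
    proof -
      have "(\<lambda>n. prob (\<Union>i<n. A i)) \<longlonglongrightarrow> prob (\<Union>n. \<Union>i<n. A i)"
      proof (rule finite_Lim_measure_incseq)
        show "incseq (\<lambda>n. \<Union>i<n. A i)" by (rule monoI, rule UN_mono) auto
      qed auto
      moreover have "(\<Union>n. \<Union>i<n. A i) = (\<Union>i. A i)" by auto
      ultimately show ?thesis by simp
    qed
    show ?case
    proof (rule H_lim)
      show "integrable M (indicat_real (\<Union>i. A i))" by (intro integrable_real_indicator) (auto simp: less_top[symmetric])
      fix e :: real assume "e > 0"
      then obtain n where n: "\<bar>prob (\<Union>i<n. A i) - prob (\<Union>i. A i)\<bar> < e"
        using LIMSEQ_D[OF lim] by fastforce
      have "(\<integral>x. \<bar>indicat_real (\<Union>i. A i) x - indicat_real (\<Union>i<n. A i) x\<bar> \<partial>M) =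
          (\<integral>x. indicat_real (\<Union>i. A i) x - indicat_real (\<Union>i<n. A i) x \<partial>M)"
        by (intro Bochner_Integration.integral_cong) (auto simp: indicator_def)
      also have "\<dots> = prob (\<Union>i. A i) - prob (\<Union>i<n. A i)"
        by (subst Bochner_Integration.integral_diff) (auto simp: less_top[symmetric])
      also have "\<dots> < e" using n by simp
      finally show "\<exists>g. H g \<and> (\<integral>x. \<bar>indicat_real (\<Union>i. A i) x - g x\<bar> \<partial>M) < e"
        using fin by blast
    qed
  qed
  define F where "F = sigma (space M) C"
  have setsF: "sets F = sigma_sets (space M) C" unfolding F_def using CP by simp
  have sa: "subalgebra M F" unfolding subalgebra_def setsF using sub CP by (simp add: F_def space_measure_of_conv)
  \<comment> \<open>Over the restricted measure, the induction on integrable functions runs only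
    through simple functions with sets in \<open>sigma_sets (space M) C\<close>.\<close>
  define N where "N = restr_to_subalg M F"
  have fN: "integrable N f" unfolding N_def using f sa by (intro integrable_in_subalg) (auto simp: F_def)
  have toM: "integrable M g" if "integrable N g" for g :: "'a \<Rightarrow> real"
    using that sa unfolding N_def by (rule integrable_from_subalg[rotated])
  have "H f"
    using fN
  proof (induction rule: integrable_induct)
    case (base A c)
    then have "A \<in> sigma_sets (space M) C" using setsF sets_restr_to_subalg[OF sa] by (simp add: N_def)
    from H_scale[OF H_ind[OF this], of c] show ?case by (simp add: mult.commute)
  next
    case (add f g) then show ?case by (intro H_add)
  next
    case (lim f s)
    show ?case
    proof (rule H_lim)
      show fM: "integrable M f" using toM lim by blast
      have sM: "integrable M (s i)" for i using toM lim by blast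
      have sp: "space N = space M" by (simp add: N_def space_restr_to_subalg)
      \<comment> \<open>The factor 3 in the dominating function comes from approximants bounded by
        twice \<open>\<bar>f x\<bar>\<close>.\<close>
      have "(\<lambda>i. \<integral>x. \<bar>f x - s i x\<bar> \<partial>M) \<longlonglongrightarrow> (\<integral>x. 0 \<partial>M)"
      proof (rule integral_dominated_convergence[where w="\<lambda>x. 3 * \<bar>f x\<bar>"])
        show "AE x in M. (\<lambda>i. \<bar>f x - s i x\<bar>) \<longlonglongrightarrow> 0"
        proof (rule AE_I2)
          fix x assume "x \<in> space M"
          then have "(\<lambda>i. s i x) \<longlonglongrightarrow> f x" using lim sp by simp
          from tendsto_rabs[OF tendsto_diff[OF tendsto_const[of "f x"] this]]
          show "(\<lambda>i. \<bar>f x - s i x\<bar>) \<longlonglongrightarrow> 0" by simp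
        qed
        show "AE x in M. norm \<bar>f x - s i x\<bar> \<le> 3 * \<bar>f x\<bar>" for i
        proof (rule AE_I2)
          fix x assume "x \<in> space M"
          then have "norm (s i x) \<le> 2 * norm (f x)" using lim sp by simp
          then show "norm \<bar>f x - s i x\<bar> \<le> 3 * \<bar>f x\<bar>" by simp
        qed
      qed (use fM sM in auto)
      then have L: "(\<lambda>i. \<integral>x. \<bar>f x - s i x\<bar> \<partial>M) \<longlonglongrightarrow> 0" by simp
      show "\<exists>g. H g \<and> (\<integral>x. \<bar>f x - g x\<bar> \<partial>M) < e" if e: "e > 0" for e :: real
      proof -
        obtain i where "(\<integral>x. \<bar>f x - s i x\<bar> \<partial>M) < e" using LIMSEQ_D[OF L e] by fastforce
        then show ?thesis using lim.IH[of i] by blast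
      qed
    qed
  qed
  then show ?thesis using \<open>e > 0\<close> unfolding H_def by blast
qed

text \<open>The common bound \<open>K\<close> makes products converge in L1 as well: the difference
  of the products is \<open>g * (f - fn)\<close> plus \<open>fn * (g - gn)\<close>, with bounded
  prefactors.\<close>

lemma (in prob_space) tendsto_covar_L1:
  fixes f g :: "'a \<Rightarrow> real" and fn gn :: "nat \<Rightarrow> 'a \<Rightarrow> real"
  assumes m[measurable]: "f \<in> borel_measurable M" "g \<in> borel_measurable M"
      "\<And>n. fn n \<in> borel_measurable M" "\<And>n. gn n \<in> borel_measurable M"
    and b: "\<And>x. \<bar>f x\<bar> \<le> K" "\<And>x. \<bar>g x\<bar> \<le> K" "\<And>n x. \<bar>fn n x\<bar> \<le> K" "\<And>n x. \<bar>gn n x\<bar> \<le> K"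
    and l: "(\<lambda>n. \<integral>x. \<bar>f x - fn n x\<bar> \<partial>M) \<longlonglongrightarrow> 0" "(\<lambda>n. \<integral>x. \<bar>g x - gn n x\<bar> \<partial>M) \<longlonglongrightarrow> 0"
  shows "(\<lambda>n. covar M (fn n) (gn n)) \<longlonglongrightarrow> covar M f g"
proof -
  note ib = integrable_bounded
  note [simp] = ib[OF m(1) b(1)] ib[OF m(2) b(2)] ib[OF m(3) b(3)] ib[OF m(4) b(4)]
    integrable_bounded_mult[OF m(1) b(1) m(2) b(2)] integrable_bounded_mult[OF m(3) b(3) m(4) b(4)]
  have L: "(\<lambda>n. \<integral>x. hn n x \<partial>M) \<longlonglongrightarrow> (\<integral>x. h x \<partial>M)"
    if [simp]: "integrable M h" "\<And>n. integrable M (hn n)" and "(\<lambda>n. \<integral>x. \<bar>h x - hn n x\<bar> \<partial>M) \<longlonglongrightarrow> 0"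
    for h :: "'a \<Rightarrow> real" and hn :: "nat \<Rightarrow> 'a \<Rightarrow> real"
  proof (rule LIM_zero_cancel, rule Lim_null_comparison[OF _ that(3)], rule always_eventually, rule allI)
    fix n
    have "norm ((\<integral>x. hn n x \<partial>M) - (\<integral>x. h x \<partial>M)) = \<bar>\<integral>x. h x - hn n x \<partial>M\<bar>" by simp
    also have "\<dots> \<le> (\<integral>x. \<bar>h x - hn n x\<bar> \<partial>M)" by (rule integral_abs_bound)
    finally show "norm ((\<integral>x. hn n x \<partial>M) - (\<integral>x. h x \<partial>M)) \<le> (\<integral>x. \<bar>h x - hn n x\<bar> \<partial>M)" .
  qed
  have "(\<lambda>n. \<integral>x. \<bar>f x * g x - fn n x * gn n x\<bar> \<partial>M) \<longlonglongrightarrow> 0"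
  proof (rule Lim_null_comparison)
    show "(\<lambda>n. K * (\<integral>x. \<bar>f x - fn n x\<bar> \<partial>M) + K * (\<integral>x. \<bar>g x - gn n x\<bar> \<partial>M)) \<longlonglongrightarrow> 0"
      using tendsto_add[OF tendsto_mult_right_zero[OF l(1), of K] tendsto_mult_right_zero[OF l(2), of K]] by simp
    show "\<forall>\<^sub>F n in sequentially. norm (\<integral>x. \<bar>f x * g x - fn n x * gn n x\<bar> \<partial>M) \<le>
        K * (\<integral>x. \<bar>f x - fn n x\<bar> \<partial>M) + K * (\<integral>x. \<bar>g x - gn n x\<bar> \<partial>M)"
    proof (rule always_eventually, rule allI)
      fix n
      have "(\<integral>x. \<bar>f x * g x - fn n x * gn n x\<bar> \<partial>M) \<le> (\<integral>x. K * \<bar>f x - fn n x\<bar> + K * \<bar>g x - gn n x\<bar> \<partial>M)"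
      proof (intro integral_mono)
        fix x
        have "f x * g x - fn n x * gn n x = g x * (f x - fn n x) + fn n x * (g x - gn n x)"
          by (simp add: algebra_simps)
        also have "\<bar>\<dots>\<bar> \<le> \<bar>g x\<bar> * \<bar>f x - fn n x\<bar> + \<bar>fn n x\<bar> * \<bar>g x - gn n x\<bar>"
          by (metis abs_mult abs_triangle_ineq)
        also have "\<dots> \<le> K * \<bar>f x - fn n x\<bar> + K * \<bar>g x - gn n x\<bar>"
          using b by (intro add_mono mult_right_mono) auto
        finally show "\<bar>f x * g x - fn n x * gn n x\<bar> \<le> K * \<bar>f x - fn n x\<bar> + K * \<bar>g x - gn n x\<bar>" .
      qed auto
      then show "norm (\<integral>x. \<bar>f x * g x - fn n x * gn n x\<bar> \<partial>M) \<le>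
          K * (\<integral>x. \<bar>f x - fn n x\<bar> \<partial>M) + K * (\<integral>x. \<bar>g x - gn n x\<bar> \<partial>M)" by simp
    qed
  qed
  then show ?thesis
    unfolding covar_def using l by (intro tendsto_diff tendsto_mult L) auto
qed

lemma covar_le_limit:
  assumes "\<And>n. covar_le M r (fn n) (gn n)"
    and "(\<lambda>n. covar M (fn n) (gn n)) \<longlonglongrightarrow> covar M f g"
    and "(\<lambda>n. covar M (fn n) (fn n)) \<longlonglongrightarrow> covar M f f"
    and "(\<lambda>n. covar M (gn n) (gn n)) \<longlonglongrightarrow> covar M g g"
  shows "covar_le M r f g"
  unfolding covar_le_def
proof (rule LIMSEQ_le)
  show "(\<lambda>n. 2 * covar M (fn n) (gn n)) \<longlonglongrightarrow> 2 * covar M f g"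
    by (intro tendsto_intros assms)
  show "(\<lambda>n. r * (covar M (fn n) (fn n) + covar M (gn n) (gn n))) \<longlonglongrightarrow> r * (covar M f f + covar M g g)"
    by (intro tendsto_intros assms)
qed (use assms(1) in \<open>auto simp: covar_le_def\<close>)

section \<open>Truncation at a level\<close>

definition clip :: "real \<Rightarrow> real \<Rightarrow> real" where
  "clip K x = max (- K) (min K x)"

lemma clip_measurable[measurable]: "clip K \<in> borel_measurable borel"
  unfolding clip_def[abs_def] by measurable

lemma abs_clip_le: "K \<ge> 0 \<Longrightarrow> \<bar>clip K x\<bar> \<le> K"
  by (auto simp: clip_def)

lemma abs_clip_le_abs: "K \<ge> 0 \<Longrightarrow> \<bar>clip K x\<bar> \<le> \<bar>x\<bar>"
  by (auto simp: clip_def)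

text \<open>Clipping at the bound of the target function therefore never worsens an approximation,
  and makes the approximants uniformly bounded.\<close>

lemma clip_nonexpansive: "\<bar>clip K x - clip K y\<bar> \<le> \<bar>x - y\<bar>"
  by (auto simp: clip_def max_def min_def)

lemma clip_eq: "\<bar>x\<bar> \<le> K \<Longrightarrow> clip K x = x"
  by (auto simp: clip_def)

lemma clip_tendsto: "(\<lambda>n. clip (real n) x) \<longlonglongrightarrow> x"
proof (rule tendsto_eventually)
  show "\<forall>\<^sub>F n in sequentially. clip (real n) x = x"
    using eventually_ge_at_top[of "nat \<lceil>\<bar>x\<bar>\<rceil>"]
  proof eventually_elim
    case (elim n)
    then have "\<bar>x\<bar> \<le> real n" by linarith
    then show ?case by (rule clip_eq)
  qed
qed

lemma (in prob_space) tendsto_covar_clip: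
  fixes f g :: "'a \<Rightarrow> real"
  assumes m[measurable]: "f \<in> borel_measurable M" "g \<in> borel_measurable M"
    and f2: "integrable M (\<lambda>x. (f x)\<^sup>2)" and g2: "integrable M (\<lambda>x. (g x)\<^sup>2)"
  shows "(\<lambda>n. covar M (\<lambda>x. clip (real n) (f x)) (\<lambda>x. clip (real n) (g x))) \<longlonglongrightarrow> covar M f g"
proof -
  have i: "integrable M f" "integrable M g"
    using square_integrable_imp_integrable m f2 g2 by blast+
  show ?thesis unfolding covar_def
  proof (intro tendsto_diff tendsto_mult)
    show "(\<lambda>n. \<integral>x. clip (real n) (f x) * clip (real n) (g x) \<partial>M) \<longlonglongrightarrow> (\<integral>x. f x * g x \<partial>M)"
    proof (rule integral_dominated_convergence[where w="\<lambda>x. (f x)\<^sup>2 + (g x)\<^sup>2"])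
      show "AE x in M. norm (clip (real n) (f x) * clip (real n) (g x)) \<le> (f x)\<^sup>2 + (g x)\<^sup>2" for n
      proof (rule AE_I2)
        fix x
        have "\<bar>clip (real n) (f x)\<bar> * \<bar>clip (real n) (g x)\<bar> \<le> \<bar>f x\<bar> * \<bar>g x\<bar>"
          by (intro mult_mono abs_clip_le_abs) auto
        also have "\<dots> \<le> (f x)\<^sup>2 + (g x)\<^sup>2"
        proof -
          have "0 \<le> \<bar>f x\<bar> * \<bar>g x\<bar>" by simp
          with sum_squares_bound[of "\<bar>f x\<bar>" "\<bar>g x\<bar>"] show ?thesis unfolding power2_abs by linarith
        qed
        finally show "norm (clip (real n) (f x) * clip (real n) (g x)) \<le> (f x)\<^sup>2 + (g x)\<^sup>2"
          by (simp add: abs_mult)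
      qed
    qed (use f2 g2 in \<open>auto intro!: tendsto_mult clip_tendsto\<close>)
    show "(\<lambda>n. \<integral>x. clip (real n) (f x) \<partial>M) \<longlonglongrightarrow> (\<integral>x. f x \<partial>M)"
      by (rule integral_dominated_convergence[where w="\<lambda>x. \<bar>f x\<bar>"])
         (use i in \<open>auto intro!: clip_tendsto abs_clip_le_abs\<close>)
    show "(\<lambda>n. \<integral>x. clip (real n) (g x) \<partial>M) \<longlonglongrightarrow> (\<integral>x. g x \<partial>M)"
      by (rule integral_dominated_convergence[where w="\<lambda>x. \<bar>g x\<bar>"])
         (use i in \<open>auto intro!: clip_tendsto abs_clip_le_abs\<close>)
  qed
qed

text \<open>Here \<open>u i\<close> is what an observer sees of coordinate \<open>i\<close>.
  Dependence through \<open>u\<close> is stated as invariance rather than as a preimage, so no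
  measurable structure is imposed on the values of \<open>u\<close>.\<close>

definition cylinder_events :: "('i \<Rightarrow> 'b pmf) \<Rightarrow> ('i \<Rightarrow> 'b \<Rightarrow> 'c) \<Rightarrow> ('i \<Rightarrow> 'b) set set" where
  "cylinder_events p u = {A \<in> sets (PiM UNIV (\<lambda>i. measure_pmf (p i))).
     \<exists>J. finite J \<and> (\<forall>w w'. (\<forall>j\<in>J. u j (w j) = u j (w' j)) \<longrightarrow> (w \<in> A \<longleftrightarrow> w' \<in> A))}"

definition cylinder_fun :: "('i \<Rightarrow> 'b pmf) \<Rightarrow> ('i \<Rightarrow> 'b \<Rightarrow> 'c) \<Rightarrow> (('i \<Rightarrow> 'b) \<Rightarrow> real) \<Rightarrow> bool" where
  "cylinder_fun p u f \<longleftrightarrow> f \<in> borel_measurable (PiM UNIV (\<lambda>i. measure_pmf (p i))) \<and>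
     (\<exists>K. \<forall>w. \<bar>f w\<bar> \<le> K) \<and>
     (\<exists>J. finite J \<and> (\<forall>w w'. (\<forall>j\<in>J. u j (w j) = u j (w' j)) \<longrightarrow> f w = f w'))"

text \<open>A binary \<open>F\<close> covers sums, multiples and clipping at once; the union of two
  finite supports is a finite support.\<close>

lemma cylinder_fun_comp2:
  assumes f: "cylinder_fun p u f" and g: "cylinder_fun p u g"
    and "(\<lambda>w. F (f w) (g w)) \<in> borel_measurable (PiM UNIV (\<lambda>i. measure_pmf (p i)))"
    and "\<And>K L. \<exists>B. \<forall>x y. \<bar>x\<bar> \<le> K \<longrightarrow> \<bar>y\<bar> \<le> L \<longrightarrow> \<bar>F x y\<bar> \<le> B"
  shows "cylinder_fun p u (\<lambda>w. F (f w) (g w))"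
proof -
  from f obtain K J where 1: "\<And>w. \<bar>f w\<bar> \<le> K" "finite J"
    "\<And>w w'. (\<forall>j\<in>J. u j (w j) = u j (w' j)) \<Longrightarrow> f w = f w'" unfolding cylinder_fun_def by metis
  from g obtain L J' where 2: "\<And>w. \<bar>g w\<bar> \<le> L" "finite J'"
    "\<And>w w'. (\<forall>j\<in>J'. u j (w j) = u j (w' j)) \<Longrightarrow> g w = g w'" unfolding cylinder_fun_def by metis
  from assms(4)[of K L] obtain B where "\<And>x y. \<bar>x\<bar> \<le> K \<Longrightarrow> \<bar>y\<bar> \<le> L \<Longrightarrow> \<bar>F x y\<bar> \<le> B" by blast
  with 1(1) 2(1) have "\<forall>w. \<bar>F (f w) (g w)\<bar> \<le> B" by blast
  moreover have "F (f w) (g w) = F (f w') (g w')" if "\<forall>j\<in>J \<union> J'. u j (w j) = u j (w' j)" for w w'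
    using 1(3)[of w w'] 2(3)[of w w'] that by auto
  moreover have "finite (J \<union> J')" using 1 2 by simp
  ultimately show ?thesis unfolding cylinder_fun_def using assms(3) by meson
qed

lemma Int_stable_cylinder_events: "Int_stable (cylinder_events p u)"
proof (rule Int_stableI)
  fix A B assume "A \<in> cylinder_events p u" "B \<in> cylinder_events p u"
  then obtain J J' where 1: "finite J" "\<And>w w'. (\<forall>j\<in>J. u j (w j) = u j (w' j)) \<Longrightarrow> (w \<in> A \<longleftrightarrow> w' \<in> A)"
    and 2: "finite J'" "\<And>w w'. (\<forall>j\<in>J'. u j (w j) = u j (w' j)) \<Longrightarrow> (w \<in> B \<longleftrightarrow> w' \<in> B)"
    and "A \<in> sets (PiM UNIV (\<lambda>i. measure_pmf (p i)))" "B \<in> sets (PiM UNIV (\<lambda>i. measure_pmf (p i)))"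
    unfolding cylinder_events_def by auto
  moreover have "w \<in> A \<inter> B \<longleftrightarrow> w' \<in> A \<inter> B" if "\<forall>j\<in>J \<union> J'. u j (w j) = u j (w' j)" for w w'
    using 1(2)[of w w'] 2(2)[of w w'] that by auto
  moreover have "finite (J \<union> J')" using \<open>finite J\<close> \<open>finite J'\<close> by simp
  ultimately show "A \<inter> B \<in> cylinder_events p u"
    unfolding cylinder_events_def by (blast intro: sets.Int)
qed

text \<open>The tensorisation principle of Csaki and Fischer for maximal correlation.\<close>

theorem covar_le_PiM:
  fixes p :: "'i \<Rightarrow> 'b pmf" and u :: "'i \<Rightarrow> 'b \<Rightarrow> 'c" and v :: "'i \<Rightarrow> 'b \<Rightarrow> 'd"
  defines "P \<equiv> PiM UNIV (\<lambda>i. measure_pmf (p i))"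
  assumes block: "\<And>i f g. (\<And>x y. u i x = u i y \<Longrightarrow> f x = f y) \<Longrightarrow>
      (\<And>x y. v i x = v i y \<Longrightarrow> g x = g y) \<Longrightarrow> covar_le (measure_pmf (p i)) r f g"
    and f: "f \<in> borel_measurable (sigma UNIV (cylinder_events p u))"
    and g: "g \<in> borel_measurable (sigma UNIV (cylinder_events p v))"
    and f2: "integrable P (\<lambda>w. (f w)\<^sup>2)" and g2: "integrable P (\<lambda>w. (g w)\<^sup>2)"
  shows "covar_le P r f g"
proof -
  interpret prob_space P unfolding P_def by (intro prob_space_PiM prob_space_measure_pmf)
  have spP: "space P = UNIV" by (auto simp: P_def space_PiM)
  have to_P: "h \<in> borel_measurable P" if "h \<in> borel_measurable (sigma UNIV (cylinder_events p t))"
    for h and t :: "'i \<Rightarrow> 'b \<Rightarrow> 'e"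
  proof (rule measurable_mono[THEN subsetD, OF order_refl refl _ _ that])
    show "sets (sigma UNIV (cylinder_events p t)) \<subseteq> sets P"
      using sets.sigma_sets_subset[of "cylinder_events p t" P]
      by (auto simp: cylinder_events_def P_def spP[unfolded P_def])
  qed (simp add: spP space_measure_of_conv)
  \<comment> \<open>Bounded functions are L1 limits of cylinder functions obeying the same bound,
    which is what \<open>tendsto_covar_L1\<close> asks for.\<close>
  have approx: "\<exists>hn. (\<forall>n. cylinder_fun p t (hn n)) \<and> (\<forall>n w. \<bar>hn n w\<bar> \<le> K) \<and>
      (\<lambda>n. \<integral>w. \<bar>h w - hn n w\<bar> \<partial>P) \<longlonglongrightarrow> 0"
    if h: "h \<in> borel_measurable (sigma UNIV (cylinder_events p t))" and hK: "\<And>w. \<bar>h w\<bar> \<le> K"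
    for h K and t :: "'i \<Rightarrow> 'b \<Rightarrow> 'e"
  proof -
    have K: "K \<ge> 0" using hK[of undefined] by linarith
    have hi: "integrable P h" by (rule integrable_bounded[OF to_P[OF h] hK])
    have mm: "cylinder_fun p t k \<Longrightarrow> k \<in> borel_measurable P" for k
      by (simp add: cylinder_fun_def P_def)
    have const: "cylinder_fun p t (\<lambda>_. 1)" unfolding cylinder_fun_def by (auto intro!: exI[of _ 1] exI[of _ "{}"])
    have "\<exists>k. cylinder_fun p t k \<and> (\<forall>w. \<bar>k w\<bar> \<le> K) \<and> (\<integral>w. \<bar>h w - k w\<bar> \<partial>P) < e" if "e > 0" for e
    proof -
      have "\<exists>k. cylinder_fun p t k \<and> (\<integral>w. \<bar>h w - k w\<bar> \<partial>P) < e"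
      proof (rule L1_dense_generated[OF prob_space_axioms Int_stable_cylinder_events[of p t]])
        show "cylinder_events p t \<subseteq> sets P" by (auto simp: cylinder_events_def P_def)
        show "integrable P k" if "cylinder_fun p t k" for k
        proof -
          from that obtain C where "\<And>w. \<bar>k w\<bar> \<le> C" unfolding cylinder_fun_def by blast
          then show ?thesis by (rule integrable_bounded[OF mm[OF that]])
        qed
        show "cylinder_fun p t (indicat_real A)" if "A \<in> cylinder_events p t" for A
        proof -
          from that obtain J where J: "finite J" "\<And>w w'. (\<forall>j\<in>J. t j (w j) = t j (w' j)) \<Longrightarrow> (w \<in> A \<longleftrightarrow> w' \<in> A)"
            and A: "A \<in> sets (PiM UNIV (\<lambda>i. measure_pmf (p i)))" unfolding cylinder_events_def by auto
          have "\<forall>w w'. (\<forall>j\<in>J. t j (w j) = t j (w' j)) \<longrightarrow> indicat_real A w = indicat_real A w'"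
          proof (intro allI impI)
            fix w w' assume "\<forall>j\<in>J. t j (w j) = t j (w' j)"
            from J(2)[OF this] show "indicat_real A w = indicat_real A w'" by (simp add: indicator_def)
          qed
          moreover have "\<forall>w. \<bar>indicat_real A w\<bar> \<le> 1" by (simp add: indicator_def)
          moreover have "indicat_real A \<in> borel_measurable (PiM UNIV (\<lambda>i. measure_pmf (p i)))"
            by (rule borel_measurable_indicator[OF A])
          ultimately show ?thesis unfolding cylinder_fun_def using J(1) by meson
        qed
        show "cylinder_fun p t (\<lambda>x. k x + l x)" if "cylinder_fun p t k" "cylinder_fun p t l" for k l
          using that mm[OF that(1)] mm[OF that(2)]
        proof (intro cylinder_fun_comp2[where F="(+)"])
          show "\<exists>B. \<forall>x y. \<bar>x\<bar> \<le> K \<longrightarrow> \<bar>y\<bar> \<le> L \<longrightarrow> \<bar>x + y\<bar> \<le> B" for K L :: real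
            by (rule exI[of _ "K + L"]) auto
        qed (auto simp: P_def)
        show "cylinder_fun p t (\<lambda>x. a * k x)" if "cylinder_fun p t k" for k a
          using that mm[OF that(1)]
        proof (intro cylinder_fun_comp2[where F="\<lambda>x y. a * x" and g=k])
          show "\<exists>B. \<forall>x y. \<bar>x\<bar> \<le> K \<longrightarrow> \<bar>y\<bar> \<le> L \<longrightarrow> \<bar>a * x\<bar> \<le> B" for K L :: real
            by (rule exI[of _ "\<bar>a\<bar> * K"]) (auto simp: abs_mult intro!: mult_left_mono)
        qed (auto simp: P_def)
      qed (use hi h that const in \<open>auto simp: spP\<close>)
      then obtain k where k: "cylinder_fun p t k" "(\<integral>w. \<bar>h w - k w\<bar> \<partial>P) < e" by blast
      obtain C where C: "\<And>w. \<bar>k w\<bar> \<le> C" using k(1) unfolding cylinder_fun_def by blast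
      note [measurable] = mm[OF k(1)]
      have ki: "integrable P k" by (rule integrable_bounded[OF mm[OF k(1)] C])
      have ki': "integrable P (\<lambda>w. clip K (k w))"
        using K by (intro integrable_bounded[where K=K]) (auto simp: abs_clip_le)
      have "(\<integral>w. \<bar>h w - clip K (k w)\<bar> \<partial>P) \<le> (\<integral>w. \<bar>h w - k w\<bar> \<partial>P)"
      proof (intro integral_mono)
        show "\<bar>h w - clip K (k w)\<bar> \<le> \<bar>h w - k w\<bar>" for w
          using clip_nonexpansive[of K "h w" "k w"] clip_eq[OF hK] by simp
      qed (use hi ki ki' in auto)
      moreover have "cylinder_fun p t (\<lambda>w. clip K (k w))"
        using mm[OF k(1)] K by (intro cylinder_fun_comp2[OF k(1) k(1), of "\<lambda>x y. clip K x"])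
          (auto simp: P_def intro: abs_clip_le)
      ultimately show ?thesis using k(2) K by (intro exI[of _ "\<lambda>w. clip K (k w)"]) (auto intro: abs_clip_le)
    qed
    then have "\<forall>n::nat. \<exists>k. cylinder_fun p t k \<and> (\<forall>w. \<bar>k w\<bar> \<le> K) \<and> (\<integral>w. \<bar>h w - k w\<bar> \<partial>P) < 1 / Suc n"
      by simp
    then obtain hn where hn: "\<And>n::nat. cylinder_fun p t (hn n) \<and> (\<forall>w. \<bar>hn n w\<bar> \<le> K) \<and> (\<integral>w. \<bar>h w - hn n w\<bar> \<partial>P) < 1 / Suc n"
      by metis
    have "(\<lambda>n. \<integral>w. \<bar>h w - hn n w\<bar> \<partial>P) \<longlonglongrightarrow> 0"
    proof (rule Lim_null_comparison)
      show "(\<lambda>n. 1 / real (Suc n)) \<longlonglongrightarrow> 0" by (rule lim_1_over_n[THEN LIMSEQ_Suc])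
      show "\<forall>\<^sub>F n in sequentially. norm (\<integral>w. \<bar>h w - hn n w\<bar> \<partial>P) \<le> 1 / real (Suc n)"
        using hn by (intro always_eventually) (auto simp: less_imp_le)
    qed
    with hn show ?thesis by blast
  qed
  have bounded: "covar_le P r f g"
    if f: "f \<in> borel_measurable (sigma UNIV (cylinder_events p u))" and fK: "\<And>w. \<bar>f w\<bar> \<le> K"
      and g: "g \<in> borel_measurable (sigma UNIV (cylinder_events p v))" and gK: "\<And>w. \<bar>g w\<bar> \<le> K" for f g K
  proof -
    obtain fn where fn: "\<And>n. cylinder_fun p u (fn n)" "\<And>n w. \<bar>fn n w\<bar> \<le> K"
      "(\<lambda>n. \<integral>w. \<bar>f w - fn n w\<bar> \<partial>P) \<longlonglongrightarrow> 0" using approx[OF f fK] by blast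
    obtain gn where gn: "\<And>n. cylinder_fun p v (gn n)" "\<And>n w. \<bar>gn n w\<bar> \<le> K"
      "(\<lambda>n. \<integral>w. \<bar>g w - gn n w\<bar> \<partial>P) \<longlonglongrightarrow> 0" using approx[OF g gK] by blast
    have m: "fn n \<in> borel_measurable P" "gn n \<in> borel_measurable P" for n
      using fn(1) gn(1) by (auto simp: cylinder_fun_def P_def)
    show ?thesis
    proof (rule covar_le_limit)
      fix n
      obtain J where J: "finite J" "\<And>w w'. (\<forall>j\<in>J. u j (w j) = u j (w' j)) \<Longrightarrow> fn n w = fn n w'"
        using fn(1)[of n] unfolding cylinder_fun_def by metis
      obtain J' where J': "finite J'" "\<And>w w'. (\<forall>j\<in>J'. v j (w j) = v j (w' j)) \<Longrightarrow> gn n w = gn n w'"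
        using gn(1)[of n] unfolding cylinder_fun_def by metis
      \<comment> \<open>The two cylinder functions may have different supports; their union serves
        as the common index set of \<open>covar_le_cylinder\<close>.\<close>
      show "covar_le P r (fn n) (gn n)"
        unfolding P_def
      proof (rule covar_le_cylinder[where J="J \<union> J'", OF block])
        show "fn n w = fn n w'" if "\<And>j. j \<in> J \<union> J' \<Longrightarrow> u j (w j) = u j (w' j)" for w w'
          using that by (intro J(2)) auto
        show "gn n w = gn n w'" if "\<And>j. j \<in> J \<union> J' \<Longrightarrow> v j (w j) = v j (w' j)" for w w'
          using that by (intro J'(2)) auto
        show "finite (J \<union> J')" using J(1) J'(1) by simp
        show "fn n \<in> borel_measurable (PiM UNIV (\<lambda>i. measure_pmf (p i)))"
          "gn n \<in> borel_measurable (PiM UNIV (\<lambda>i. measure_pmf (p i)))" using m by (simp_all add: P_def)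
      qed (rule fn(2) gn(2) | assumption)+
      show "(\<lambda>n. covar P (fn n) (gn n)) \<longlonglongrightarrow> covar P f g"
        using to_P[OF f] to_P[OF g] m fK gK fn(2) gn(2) fn(3) gn(3) by (rule tendsto_covar_L1)
      show "(\<lambda>n. covar P (fn n) (fn n)) \<longlonglongrightarrow> covar P f f"
        using to_P[OF f] to_P[OF f] m(1) m(1) fK fK fn(2) fn(2) fn(3) fn(3) by (rule tendsto_covar_L1)
      show "(\<lambda>n. covar P (gn n) (gn n)) \<longlonglongrightarrow> covar P g g"
        using to_P[OF g] to_P[OF g] m(2) m(2) gK gK gn(2) gn(2) gn(3) gn(3) by (rule tendsto_covar_L1)
    qed
  qed
  \<comment> \<open>Clipping keeps measurability with respect to the same sigma-algebras, so the
    bounded case applies at every level \<open>n\<close>; square integrability lets the covariances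
    pass to the limit.\<close>
  show ?thesis
  proof (rule covar_le_limit)
    show "covar_le P r (\<lambda>w. clip (real n) (f w)) (\<lambda>w. clip (real n) (g w))" for n
      by (rule bounded[of _ "real n"]) (use f g in \<open>auto intro: abs_clip_le\<close>)
  qed (rule tendsto_covar_clip; use to_P[OF f] to_P[OF g] f2 g2 in blast)+
qed

subsection \<open>Mixing coefficients and tilted blocks\<close>

lemma covar_scale: "covar M (\<lambda>x. s * f x) (\<lambda>x. t * g x) = s * t * covar M f g"
proof -
  have "(\<integral>x. (s * f x) * (t * g x) \<partial>M) = (\<integral>x. (s * t) * (f x * g x) \<partial>M)"
    by (intro Bochner_Integration.integral_cong) (auto simp: algebra_simps)
  then show ?thesis by (simp add: covar_def algebra_simps)
qed

text \<open>Scaling both functions to variance one makes the right side \<open>2 * r\<close> and the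
  left side twice the correlation; a further sign yields the absolute value. This is why the
  hypothesis is asked for all multiples. For a vanishing variance \<open>corr\<close> is 0 by
  convention.\<close>

lemma abs_corr_le:
  assumes "r \<ge> 0" and le: "\<And>s t. covar_le M r (\<lambda>x. s * f x) (\<lambda>x. t * g x)"
    and nn: "0 \<le> covar M f f" "0 \<le> covar M g g"
  shows "\<bar>corr M f g\<bar> \<le> r"
proof (cases "covar M f f = 0 \<or> covar M g g = 0")
  case True
  then show ?thesis using assms(1) by (auto simp: corr_def)
next
  case False
  define a where "a = sqrt (covar M f f)"
  define b where "b = sqrt (covar M g g)"
  have ab: "a > 0" "b > 0" "covar M f f = a * a" "covar M g g = b * b"
    using False nn by (auto simp: a_def b_def)
  have 1: "s * corr M f g \<le> r" if "\<bar>s\<bar> = 1" for s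
  proof -
    have "s * s = 1" using that by (metis abs_mult_self_eq mult_1)
    with le[of "s / a" "1 / b"] ab show ?thesis
      unfolding covar_le_def covar_scale corr_def a_def[symmetric] b_def[symmetric]
      by (simp add: field_simps)
  qed
  from 1[of 1] 1[of "-1"] show ?thesis by simp
qed

text \<open>Collects what one covariance inequality implies for both coefficients. The lower
  estimates rely on \<open>r\<close> too: a real \<open>Sup\<close> dominates the members of its set
  only if that set is bounded above.\<close>

locale covar_bounded = prob_space M for M :: "'a measure" +
  fixes A B :: "'a set set" and r :: real
  assumes A: "sigma_algebra (space M) A" "A \<subseteq> sets M"
    and B: "sigma_algebra (space M) B" "B \<subseteq> sets M"
    and r: "0 \<le> r"
    and le: "\<And>f g. f \<in> borel_measurable (sigma (space M) A) \<Longrightarrow> g \<in> borel_measurable (sigma (space M) B) \<Longrightarrow>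
      integrable M (\<lambda>x. (f x)\<^sup>2) \<Longrightarrow> integrable M (\<lambda>x. (g x)\<^sup>2) \<Longrightarrow> covar_le M r f g"
begin

lemma sets_sigma_A: "sets (sigma (space M) A) = A"
proof -
  have "A \<subseteq> Pow (space M)" using A(2) sets.space_closed by blast
  then show ?thesis using sigma_algebra.sigma_sets_eq[OF A(1)] by simp
qed

lemma sets_sigma_B: "sets (sigma (space M) B) = B"
proof -
  have "B \<subseteq> Pow (space M)" using B(2) sets.space_closed by blast
  then show ?thesis using sigma_algebra.sigma_sets_eq[OF B(1)] by simp
qed

lemma measurable_A:
  assumes "f \<in> borel_measurable (sigma (space M) A)"
  shows "f \<in> borel_measurable M"
  using measurable_mono[THEN subsetD, OF order_refl refl _ _ assms, of M] A sets_sigma_A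
  by (simp add: space_measure_of_conv)

lemma measurable_B:
  assumes "f \<in> borel_measurable (sigma (space M) B)"
  shows "f \<in> borel_measurable M"
  using measurable_mono[THEN subsetD, OF order_refl refl _ _ assms, of M] B sets_sigma_B
  by (simp add: space_measure_of_conv)

lemma covar_self_nonneg_square:
  assumes "f \<in> borel_measurable M" "integrable M (\<lambda>x. (f x)\<^sup>2)"
  shows "0 \<le> covar M f f"
  using assms square_integrable_imp_integrable[OF assms]
  by (intro covar_self_nonneg) (auto simp: power2_eq_square)

lemma corr_bound:
  assumes "f \<in> borel_measurable (sigma (space M) A)" "g \<in> borel_measurable (sigma (space M) B)"
    "integrable M (\<lambda>x. (f x)\<^sup>2)" "integrable M (\<lambda>x. (g x)\<^sup>2)"
  shows "\<bar>corr M f g\<bar> \<le> r"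
proof (rule abs_corr_le[OF r])
  show "covar_le M r (\<lambda>x. s * f x) (\<lambda>x. t * g x)" for s t
    using assms by (intro le) (auto simp: power_mult_distrib)
qed (use assms covar_self_nonneg_square measurable_A measurable_B in blast)+

lemma rho_coef_le: "rho_coef M A B \<le> r"
  unfolding rho_coef_def
proof (rule cSup_least)
  show "{\<bar>corr M f g\<bar> | f g. f \<in> borel_measurable (sigma (space M) A) \<and> g \<in> borel_measurable (sigma (space M) B) \<and>
     integrable M (\<lambda>x. (f x)\<^sup>2) \<and> integrable M (\<lambda>x. (g x)\<^sup>2)} \<noteq> {}"
    by (auto intro!: exI[of _ "\<lambda>_. 0"])
qed (auto intro: corr_bound)

lemma rho_coef_ge:
  assumes "f \<in> borel_measurable (sigma (space M) A)" "g \<in> borel_measurable (sigma (space M) B)"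
    "integrable M (\<lambda>x. (f x)\<^sup>2)" "integrable M (\<lambda>x. (g x)\<^sup>2)"
  shows "\<bar>corr M f g\<bar> \<le> rho_coef M A B"
  unfolding rho_coef_def
  by (rule cSup_upper) (use assms in \<open>auto intro!: bdd_aboveI[of _ r] corr_bound\<close>)

lemma covar_indicator:
  assumes "a \<in> sets M" "b \<in> sets M"
  shows "covar M (indicat_real a) (indicat_real b) = prob (a \<inter> b) - prob a * prob b"
proof -
  have "(\<integral>x. indicat_real a x * indicat_real b x \<partial>M) = (\<integral>x. indicat_real (a \<inter> b) x \<partial>M)"
    by (simp add: indicator_inter_arith)
  then show ?thesis using assms by (simp add: covar_def)
qed

lemma indicator_A: "a \<in> A \<Longrightarrow> indicat_real a \<in> borel_measurable (sigma (space M) A)"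
  by (rule borel_measurable_indicator) (simp add: sets_sigma_A del: sets_measure_of_conv)

lemma indicator_B: "b \<in> B \<Longrightarrow> indicat_real b \<in> borel_measurable (sigma (space M) B)"
  by (rule borel_measurable_indicator) (simp add: sets_sigma_B del: sets_measure_of_conv)

lemma integrable_indicator_square:
  "a \<in> sets M \<Longrightarrow> integrable M (\<lambda>x. (s * indicat_real a x)\<^sup>2)"
  by (rule integrable_bounded[where K="s\<^sup>2"]) (auto simp: indicator_def)

text \<open>An indicator has variance \<open>p - p * p\<close>, at most 1/4, so the inequality for
  two indicators, one of them with a sign, bounds twice their covariance by
  \<open>r / 2\<close>.\<close>

lemma alpha_bound:
  assumes "a \<in> A" "b \<in> B"
  shows "4 * \<bar>prob (a \<inter> b) - prob a * prob b\<bar> \<le> r"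
proof -
  have ab: "a \<in> sets M" "b \<in> sets M" using assms A B by auto
  have var: "covar M (indicat_real c) (indicat_real c) \<le> 1 / 4" if "c \<in> sets M" for c
    using covar_indicator[OF that that] zero_le_power2[of "prob c - 1 / 2"]
    by (simp add: power2_eq_square algebra_simps)
  have nn: "0 \<le> covar M (indicat_real c) (indicat_real c)" if "c \<in> sets M" for c
    using that integrable_indicator_square[OF that, of 1] by (intro covar_self_nonneg_square) auto
  have 1: "s * (prob (a \<inter> b) - prob a * prob b) \<le> r / 4" if "\<bar>s\<bar> = 1" for s
  proof -
    have s: "s * s = 1" using that by (metis abs_mult_self_eq mult_1)
    have "covar_le M r (\<lambda>x. s * indicat_real a x) (\<lambda>x. 1 * indicat_real b x)"
      using indicator_A[OF assms(1)] indicator_B[OF assms(2)] ab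
      by (intro le integrable_indicator_square borel_measurable_times borel_measurable_const)
    then have "2 * (s * (prob (a \<inter> b) - prob a * prob b)) \<le>
        r * (covar M (indicat_real a) (indicat_real a) + covar M (indicat_real b) (indicat_real b))"
      unfolding covar_le_def covar_scale s using covar_indicator[OF ab] by simp
    also have "\<dots> \<le> r * (1 / 4 + 1 / 4)"
      using r var ab by (intro mult_left_mono add_mono) auto
    finally show ?thesis by simp
  qed
  from 1[of 1] 1[of "-1"] show ?thesis by (auto simp: abs_if)
qed

lemma alpha_coef_le: "4 * alpha_coef M A B \<le> r"
proof -
  interpret SA: sigma_algebra "space M" A by (rule A(1))
  interpret SB: sigma_algebra "space M" B by (rule B(1))
  have "alpha_coef M A B \<le> r / 4"
    unfolding alpha_coef_def
  proof (rule cSup_least)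
    show "{\<bar>measure M (a \<inter> b) - measure M a * measure M b\<bar> | a b. a \<in> A \<and> b \<in> B} \<noteq> {}"
      using SA.empty_sets SB.empty_sets by blast
  qed (use alpha_bound in force)
  then show ?thesis by simp
qed

lemma alpha_coef_ge:
  assumes "a \<in> A" "b \<in> B"
  shows "\<bar>prob (a \<inter> b) - prob a * prob b\<bar> \<le> alpha_coef M A B"
  unfolding alpha_coef_def
  by (rule cSup_upper) (use assms alpha_bound in \<open>force intro!: bdd_aboveI[of _ "r / 4"]\<close>)+

text \<open>Events of probability 1/2 have variance exactly 1/4, the equality case of
  \<open>alpha_bound\<close>; their correlation is four times their covariance.\<close>

lemma rho_coef_ge_events:
  assumes "a \<in> A" "b \<in> B" "prob a = 1 / 2" "prob b = 1 / 2"
  shows "4 * \<bar>prob (a \<inter> b) - prob a * prob b\<bar> \<le> rho_coef M A B"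
proof -
  have ab: "a \<in> sets M" "b \<in> sets M" using assms A B by auto
  have "corr M (indicat_real a) (indicat_real b) = 4 * (prob (a \<inter> b) - prob a * prob b)"
    using ab unfolding corr_def by (simp add: covar_indicator assms(3,4) real_sqrt_divide)
  then have "4 * \<bar>prob (a \<inter> b) - prob a * prob b\<bar> = \<bar>corr M (indicat_real a) (indicat_real b)\<bar>"
    by (simp only: abs_mult abs_numeral)
  also have "\<dots> \<le> rho_coef M A B"
    using indicator_A[OF assms(1)] indicator_B[OF assms(2)] integrable_indicator_square[OF ab(1), of 1]
      integrable_indicator_square[OF ab(2), of 1]
    by (intro rho_coef_ge) simp_all
  finally show ?thesis .
qed

end

section \<open>Parity and averages over finitely many fair signs\<close>

definition parity :: "nat set \<Rightarrow> real" where
  "parity A = (- 1) ^ card A"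

text \<open>Expectation under fair coin tossing on \<open>S\<close>. A subset lists the signs equal
  to -1, so \<open>parity\<close> is the product of the signs.\<close>

definition avg :: "nat set \<Rightarrow> (nat set \<Rightarrow> real) \<Rightarrow> real" where
  "avg S f = (\<Sum>B\<in>Pow S. f B) / 2 ^ card S"

lemma parity_empty [simp]: "parity {} = 1"
  by (simp add: parity_def)

lemma parity_mult_self [simp]: "parity A * parity A = 1"
  by (simp add: parity_def power_mult_distrib[symmetric])

lemma abs_parity [simp]: "\<bar>parity A\<bar> = 1"
  by (simp add: parity_def power_abs)

lemma parity_Un: "finite A \<Longrightarrow> finite B \<Longrightarrow> A \<inter> B = {} \<Longrightarrow> parity (A \<union> B) = parity A * parity B"
  by (simp add: parity_def card_Un_disjoint power_add)

lemma sum_Pow_Un: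
  assumes "S \<inter> T = {}"
  shows "(\<Sum>A\<in>Pow (S \<union> T). h A) = (\<Sum>B\<in>Pow S. \<Sum>C\<in>Pow T. h (B \<union> C))"
  unfolding sum.cartesian_product
proof (rule sum.reindex_bij_witness[where i="\<lambda>(B, C). B \<union> C" and j="\<lambda>A. (A \<inter> S, A \<inter> T)"])
  fix A assume "A \<in> Pow (S \<union> T)"
  then have "A \<inter> S \<union> A \<inter> T = A" by blast
  then show "(case (A \<inter> S, A \<inter> T) of (B, C) \<Rightarrow> B \<union> C) = A"
    "(case (A \<inter> S, A \<inter> T) of (B, C) \<Rightarrow> h (B \<union> C)) = h A" by simp_all
next
  fix z assume z: "z \<in> Pow S \<times> Pow T"
  obtain B C where [simp]: "z = (B, C)" by fastforce
  have "(B \<union> C) \<inter> S = B" "(B \<union> C) \<inter> T = C" using z assms by auto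
  then show "((case z of (B, C) \<Rightarrow> B \<union> C) \<inter> S, (case z of (B, C) \<Rightarrow> B \<union> C) \<inter> T) = z"
    by simp
qed auto

lemma avg_Un:
  assumes "finite S" "finite T" "S \<inter> T = {}"
  shows "avg (S \<union> T) h = avg S (\<lambda>B. avg T (\<lambda>C. h (B \<union> C)))"
  using assms unfolding avg_def
  by (simp add: sum_Pow_Un card_Un_disjoint power_add sum_divide_distrib field_simps)

lemma avg_cong: "(\<And>B. B \<subseteq> S \<Longrightarrow> f B = g B) \<Longrightarrow> avg S f = avg S g"
  unfolding avg_def by (auto intro!: arg_cong2[where f="(/)"] sum.cong)

lemma avg_add: "avg S (\<lambda>B. f B + g B) = avg S f + avg S g"
  by (simp add: avg_def sum.distrib add_divide_distrib)

lemma avg_scale: "avg S (\<lambda>B. a * f B) = a * avg S f"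
  by (simp add: avg_def sum_distrib_left)

lemma avg_scale_right: "avg S (\<lambda>B. f B * a) = avg S f * a"
  by (simp add: avg_def sum_distrib_right)

lemma avg_const [simp]: "finite S \<Longrightarrow> avg S (\<lambda>_. a) = a"
  by (simp add: avg_def card_Pow)

lemma avg_nonneg: "(\<And>B. 0 \<le> f B) \<Longrightarrow> 0 \<le> avg S f"
  by (simp add: avg_def sum_nonneg)

text \<open>Parity factorises over disjoint sets, and a single fair sign already averages to
  zero.\<close>

lemma avg_parity:
  assumes "finite S" "S \<noteq> {}"
  shows "avg S parity = 0"
proof -
  from assms(2) obtain x where x: "x \<in> S" by blast
  have "avg ({x} \<union> (S - {x})) parity = avg {x} (\<lambda>B. avg (S - {x}) (\<lambda>C. parity (B \<union> C)))"
    using assms(1) by (intro avg_Un) auto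
  also have "\<dots> = avg {x} (\<lambda>B. parity B * avg (S - {x}) parity)"
  proof (rule avg_cong)
    fix B assume B: "B \<subseteq> {x}"
    have "avg (S - {x}) (\<lambda>C. parity (B \<union> C)) = avg (S - {x}) (\<lambda>C. parity B * parity C)"
      using B assms(1) by (intro avg_cong parity_Un) (auto intro: finite_subset)
    then show "avg (S - {x}) (\<lambda>C. parity (B \<union> C)) = parity B * avg (S - {x}) parity"
      by (simp add: avg_scale)
  qed
  also have "\<dots> = avg {x} parity * avg (S - {x}) parity" by (rule avg_scale_right)
  also have "avg {x} parity = 0" by (simp add: avg_def Pow_insert parity_def)
  finally show ?thesis using x by (simp add: insert_absorb)
qed

text \<open>Bessel's inequality for the orthonormal pair consisting of the constant 1 and
  \<open>parity\<close>: the residual after projection onto both has nonnegative mean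
  square.\<close>

lemma avg_bessel:
  assumes "finite S" "S \<noteq> {}"
  shows "(avg S (\<lambda>B. f B * parity B))\<^sup>2 \<le> avg S (\<lambda>B. f B * f B) - avg S f * avg S f"
proof -
  define m where "m = avg S f"
  define a where "a = avg S (\<lambda>B. f B * parity B)"
  have "0 \<le> avg S (\<lambda>B. (f B - m - a * parity B)\<^sup>2)" by (rule avg_nonneg) simp
  also have "avg S (\<lambda>B. (f B - m - a * parity B)\<^sup>2) =
      avg S (\<lambda>B. f B * f B + ((- 2 * m) * f B + ((- 2 * a) * (f B * parity B) + ((2 * m * a) * parity B + (m\<^sup>2 + a\<^sup>2)))))"
  proof (rule avg_cong)
    fix B
    have "(f B - m - a * parity B)\<^sup>2 = f B * f B + ((- 2 * m) * f B + ((- 2 * a) * (f B * parity B) +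
        ((2 * m * a) * parity B + (m\<^sup>2 + a\<^sup>2 * (parity B * parity B)))))"
      by (simp only: power2_eq_square) (simp add: algebra_simps del: parity_mult_self)
    then show "(f B - m - a * parity B)\<^sup>2 = f B * f B + ((- 2 * m) * f B + ((- 2 * a) * (f B * parity B) +
        ((2 * m * a) * parity B + (m\<^sup>2 + a\<^sup>2))))" by simp
  qed
  also have "\<dots> = avg S (\<lambda>B. f B * f B) - m\<^sup>2 - a\<^sup>2"
    unfolding avg_add avg_scale using assms avg_parity[OF assms]
    by (simp add: m_def[symmetric] a_def[symmetric] power2_eq_square)
  finally show ?thesis by (simp add: m_def a_def power2_eq_square)
qed

text \<open>Uniform bits tilted so that their product of signs has mean \<^term>\<open>c::real\<close>; every proper
  subfamily of the bits is still uniform.\<close>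

definition block_pmf :: "nat set \<Rightarrow> real \<Rightarrow> nat set pmf" where
  "block_pmf F c = embed_pmf (\<lambda>A. if A \<subseteq> F then (1 + c * parity A) / 2 ^ card F else 0)"

context
  fixes F :: "nat set" and c :: real
  assumes F: "finite F" "F \<noteq> {}" and c: "0 \<le> c" "c \<le> 1"
begin

lemma tilt_nonneg: "0 \<le> 1 + c * parity A"
proof -
  have "\<bar>c * parity A\<bar> \<le> 1" using c by (simp add: abs_mult)
  then show ?thesis by linarith
qed

lemma pmf_block: "pmf (block_pmf F c) A = (if A \<subseteq> F then (1 + c * parity A) / 2 ^ card F else 0)"
  unfolding block_pmf_def
proof (rule pmf_embed_pmf)
  let ?w = "\<lambda>A. if A \<subseteq> F then (1 + c * parity A) / 2 ^ card F else 0"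
  show nn: "0 \<le> ?w A" for A using tilt_nonneg[of A] by simp
  have "(\<integral>\<^sup>+ A. ennreal (?w A) \<partial>count_space UNIV) = (\<Sum>A\<in>Pow F. ennreal (?w A))"
    by (rule nn_integral_count_space'[where A="Pow F"]) (use F nn in auto)
  also have "\<dots> = ennreal (\<Sum>A\<in>Pow F. ?w A)" using nn by (rule sum_ennreal)
  also have "(\<Sum>A\<in>Pow F. ?w A) = avg F (\<lambda>A. 1 + c * parity A)"
    unfolding avg_def sum_divide_distrib by (intro sum.cong) auto
  also have "\<dots> = 1" using F by (simp add: avg_add avg_scale avg_parity)
  finally show "(\<integral>\<^sup>+ A. ennreal (?w A) \<partial>count_space UNIV) = 1" by simp
qed

lemma integral_block: "(\<integral>A. h A \<partial>measure_pmf (block_pmf F c)) = avg F h + c * avg F (\<lambda>A. h A * parity A)"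
proof -
  have "(\<integral>A. h A \<partial>measure_pmf (block_pmf F c)) = (\<Sum>A\<in>Pow F. pmf (block_pmf F c) A *\<^sub>R h A)"
    by (rule integral_measure_pmf) (use F in \<open>auto simp: set_pmf_eq pmf_block split: if_splits\<close>)
  also have "\<dots> = (\<Sum>A\<in>Pow F. (h A + c * (h A * parity A)) / 2 ^ card F)"
    by (intro sum.cong) (auto simp: pmf_block algebra_simps)
  also have "\<dots> = avg F (\<lambda>A. h A + c * (h A * parity A))"
    by (simp add: avg_def sum_divide_distrib)
  finally show ?thesis by (simp add: avg_add avg_scale)
qed

text \<open>On \<open>F\<close> the parity is the product of the parities of the two parts, so the
  fair term and the tilt both factorise. The tilt sees \<open>f\<close> and \<open>g\<close> only
  through their parity coefficients, hence has rank one.\<close>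

lemma integral_block_split:
  assumes "S \<inter> T = {}" "S \<union> T = F"
  shows "(\<integral>A. f (A \<inter> S) * g (A \<inter> T) \<partial>measure_pmf (block_pmf F c)) =
    avg S f * avg T g + c * (avg S (\<lambda>B. f B * parity B) * avg T (\<lambda>C. g C * parity C))"
proof -
  have fin: "finite S" "finite T" using assms F by auto
  have split: "avg F (\<lambda>A. k (A \<inter> S) * l (A \<inter> T)) = avg S k * avg T l" for k l
  proof -
    have "avg F (\<lambda>A. k (A \<inter> S) * l (A \<inter> T)) = avg S (\<lambda>B. avg T (\<lambda>C. k ((B \<union> C) \<inter> S) * l ((B \<union> C) \<inter> T)))"
      using avg_Un[OF fin assms(1)] assms(2) by simp
    also have "\<dots> = avg S (\<lambda>B. avg T (\<lambda>C. k B * l C))"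
    proof (intro avg_cong)
      fix B C assume "B \<subseteq> S" "C \<subseteq> T"
      then have "(B \<union> C) \<inter> S = B" "(B \<union> C) \<inter> T = C" using assms(1) by auto
      then show "k ((B \<union> C) \<inter> S) * l ((B \<union> C) \<inter> T) = k B * l C" by simp
    qed
    finally show ?thesis by (simp add: avg_scale avg_scale_right)
  qed
  have "avg F (\<lambda>A. f (A \<inter> S) * g (A \<inter> T) * parity A) =
      avg F (\<lambda>A. (\<lambda>B. f B * parity B) (A \<inter> S) * (\<lambda>C. g C * parity C) (A \<inter> T))"
  proof (rule avg_cong)
    fix A assume "A \<subseteq> F"
    then have "A = (A \<inter> S) \<union> (A \<inter> T)" using assms(2) by auto
    moreover have "parity ((A \<inter> S) \<union> (A \<inter> T)) = parity (A \<inter> S) * parity (A \<inter> T)"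
      using fin assms(1) by (intro parity_Un) auto
    ultimately show "f (A \<inter> S) * g (A \<inter> T) * parity A =
        (\<lambda>B. f B * parity B) (A \<inter> S) * (\<lambda>C. g C * parity C) (A \<inter> T)" by simp
  qed
  then show ?thesis
    unfolding integral_block split[of f g] split[of "\<lambda>B. f B * parity B" "\<lambda>C. g C * parity C"] by simp
qed

text \<open>Splitting against the constant 1 on the nonempty complement: its parity coefficient
  there is a mean parity, hence zero, and the tilt disappears.\<close>

lemma integral_block_marginal:
  assumes "S \<subseteq> F" "S \<noteq> F"
  shows "(\<integral>A. f (A \<inter> S) \<partial>measure_pmf (block_pmf F c)) = avg S f"
proof -
  have "finite (F - S)" "F - S \<noteq> {}" using F assms by auto
  then show ?thesis
    using integral_block_split[of S "F - S" f "\<lambda>_. 1"] assms avg_parity[of "F - S"]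
    by (simp add: Un_absorb1)
qed

lemma prob_block_superset:
  assumes "J \<subseteq> F" "J \<noteq> F"
  shows "measure_pmf.prob (block_pmf F c) {A. J \<subseteq> A} = (1 / 2) ^ card J"
proof -
  have "finite J" using assms F finite_subset by blast
  have "measure_pmf.prob (block_pmf F c) {A. J \<subseteq> A} = (\<integral>A. indicator {A. J \<subseteq> A} A \<partial>measure_pmf (block_pmf F c))"
    by simp
  also have "\<dots> = (\<integral>A. (\<lambda>B. of_bool (B = J)) (A \<inter> J) \<partial>measure_pmf (block_pmf F c))"
    by (intro Bochner_Integration.integral_cong) (auto simp: indicator_def)
  also have "\<dots> = avg J (\<lambda>B. of_bool (B = J))" using assms by (rule integral_block_marginal)
  also have "\<dots> = (1 / 2) ^ card J"
  proof -
    have "(\<Sum>B\<in>Pow J. of_bool (B = J)) = (1::real)"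
      unfolding of_bool_def using \<open>finite J\<close> by (subst sum.delta) auto
    then show ?thesis by (simp add: avg_def power_one_over)
  qed
  finally show ?thesis .
qed

text \<open>The assumption \<open>cr\<close> compares \<open>c\<close> with \<open>r\<close> only
  when both parts are nonempty and cover \<open>F\<close>, since otherwise the covariance is zero.
  In the covering case it is \<open>c * a * b\<close> for the parity coefficients, whose squares
  Bessel bounds by the variances.\<close>

lemma covar_le_block:
  assumes ST: "S \<subseteq> F" "T \<subseteq> F" "S \<inter> T = {}" and r: "0 \<le> r"
    and cr: "S \<noteq> {} \<Longrightarrow> T \<noteq> {} \<Longrightarrow> S \<union> T = F \<Longrightarrow> c \<le> r"
    and f: "\<And>A A'. A \<inter> S = A' \<inter> S \<Longrightarrow> f A = f A'" and g: "\<And>A A'. A \<inter> T = A' \<inter> T \<Longrightarrow> g A = g A'"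
  shows "covar_le (measure_pmf (block_pmf F c)) r f g"
proof -
  let ?P = "measure_pmf (block_pmf F c)"
  have fin: "finite S" "finite T" using ST F finite_subset by blast+
  have f': "f = (\<lambda>A. f (A \<inter> S))" by (rule ext, rule f) blast
  have g': "g = (\<lambda>A. g (A \<inter> T))" by (rule ext, rule g) blast
  have int: "integrable ?P h" for h :: "nat set \<Rightarrow> real"
    by (rule integrable_measure_pmf_finite) (use F in \<open>auto simp: set_pmf_eq pmf_block intro: finite_subset[of _ "Pow F"]\<close>)
  have nn: "0 \<le> covar ?P h h" for h
    by (intro measure_pmf.covar_self_nonneg int)
  consider (triv) "S = {} \<or> T = {}" | (full) "S \<noteq> {}" "T \<noteq> {}" "S \<union> T = F" | (part) "S \<noteq> {}" "T \<noteq> {}" "S \<union> T \<noteq> F" by blast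
  then show ?thesis
  proof cases
    case triv
    have "covar ?P f g = 0"
    proof (cases "S = {}")
      case True
      then have "f = (\<lambda>_. f {})" by (intro ext f) simp
      then obtain k where "f = (\<lambda>_. k)" by blast
      then show ?thesis by (simp add: covar_def)
    next
      case False
      with triv have "g = (\<lambda>_. g {})" by (intro ext g) simp
      then obtain k where "g = (\<lambda>_. k)" by blast
      then show ?thesis by (simp add: covar_def)
    qed
    then show ?thesis using nn r by (simp add: covar_le_def)
  next
    case full
    define a where "a = avg S (\<lambda>B. f B * parity B)"
    define b where "b = avg T (\<lambda>B. g B * parity B)"
    have proper: "S \<noteq> F" "T \<noteq> F" using full ST by auto
    have mf: "(\<integral>A. k (A \<inter> S) \<partial>?P) = avg S k" and mg: "(\<integral>A. k (A \<inter> T) \<partial>?P) = avg T k" for k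
      using proper ST integral_block_marginal by blast+
    have 1: "covar ?P f g = c * (a * b)"
      unfolding covar_def a_def b_def
      by (subst (1 2) f', subst (1 2) g') (simp add: integral_block_split[OF ST(3) full(3)] mf mg)
    have "covar ?P f f = avg S (\<lambda>B. f B * f B) - avg S f * avg S f"
      unfolding covar_def by (subst (1 2 3 4) f') (simp add: mf[of f] mf[of "\<lambda>B. f B * f B"])
    then have 2: "a\<^sup>2 \<le> covar ?P f f" using avg_bessel[OF fin(1) full(1), of f] by (simp add: a_def)
    have "covar ?P g g = avg T (\<lambda>B. g B * g B) - avg T g * avg T g"
      unfolding covar_def by (subst (1 2 3 4) g') (simp add: mg[of g] mg[of "\<lambda>B. g B * g B"])
    then have 3: "b\<^sup>2 \<le> covar ?P g g" using avg_bessel[OF fin(2) full(2), of g] by (simp add: b_def)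
    have "2 * covar ?P f g = c * (2 * a * b)" using 1 by simp
    \<comment> \<open>Arithmetic-geometric mean; this is where the sum form of
      \<open>covar_le\<close> is convenient.\<close>
    also have "\<dots> \<le> c * (a\<^sup>2 + b\<^sup>2)" using c sum_squares_bound by (intro mult_left_mono) auto
    also have "\<dots> \<le> r * (covar ?P f f + covar ?P g g)"
      using 2 3 cr[OF full] r by (intro mult_mono) auto
    finally show ?thesis by (simp add: covar_le_def)
  next
    case part
    \<comment> \<open>The bits seen by neither side are added to those of \<open>T\<close>. The
      parity coefficient of \<open>g\<close> on the enlarged set contains an average of parity over
      \<open>R\<close>, so it vanishes and the fair product remains.\<close>
    define R where "R = F - (S \<union> T)"
    have R: "finite R" "R \<noteq> {}" "T \<inter> R = {}" "S \<inter> (T \<union> R) = {}" "S \<union> (T \<union> R) = F" "S \<noteq> F" "T \<noteq> F"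
      using part ST F by (auto simp: R_def)
    have "avg (T \<union> R) (\<lambda>C. g (C \<inter> T) * parity C) = avg T (\<lambda>B. avg R (\<lambda>C. g ((B \<union> C) \<inter> T) * parity (B \<union> C)))"
      using R fin by (intro avg_Un) auto
    also have "\<dots> = avg T (\<lambda>B. avg R (\<lambda>C. (g B * parity B) * parity C))"
    proof (intro avg_cong)
      fix B C assume BC: "B \<subseteq> T" "C \<subseteq> R"
      then have "(B \<union> C) \<inter> T = B" "B \<inter> C = {}" "finite B" "finite C"
        using R fin finite_subset by blast+
      then show "g ((B \<union> C) \<inter> T) * parity (B \<union> C) = (g B * parity B) * parity C"
        by (simp add: parity_Un)
    qed
    also have "\<dots> = 0" using R by (simp add: avg_scale avg_parity) (simp add: avg_def)
    finally have 0: "avg (T \<union> R) (\<lambda>C. g (C \<inter> T) * parity C) = 0" .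
    have "(\<integral>A. f A * g A \<partial>?P) = (\<integral>A. f (A \<inter> S) * (\<lambda>C. g (C \<inter> T)) (A \<inter> (T \<union> R)) \<partial>?P)"
    proof (intro Bochner_Integration.integral_cong refl)
      show "f A * g A = f (A \<inter> S) * (\<lambda>C. g (C \<inter> T)) (A \<inter> (T \<union> R))" for A
        using f[of A "A \<inter> S"] g[of A "A \<inter> (T \<union> R) \<inter> T"] by (auto simp: Int_assoc Int_absorb1)
    qed
    also have "\<dots> = avg S f * avg (T \<union> R) (\<lambda>C. g (C \<inter> T))"
      using integral_block_split[OF R(4,5), of f "\<lambda>C. g (C \<inter> T)"] 0 by simp
    also have "avg (T \<union> R) (\<lambda>C. g (C \<inter> T)) = avg T (\<lambda>B. avg R (\<lambda>C. g B))"
    proof -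
      have "avg (T \<union> R) (\<lambda>C. g (C \<inter> T)) = avg T (\<lambda>B. avg R (\<lambda>C. g ((B \<union> C) \<inter> T)))"
        using R fin by (intro avg_Un) auto
      also have "\<dots> = avg T (\<lambda>B. avg R (\<lambda>C. g B))"
        using R by (intro avg_cong g) blast
      finally show ?thesis .
    qed
    also have "\<dots> = avg T g" using R by simp
    finally have "(\<integral>A. f A * g A \<partial>?P) = avg S f * avg T g" .
    moreover have "(\<integral>A. f A \<partial>?P) = avg S f" "(\<integral>A. g A \<partial>?P) = avg T g"
      using integral_block_marginal[of S f] integral_block_marginal[of T g] R ST f'[symmetric] g'[symmetric] by auto
    ultimately have "covar ?P f g = 0" by (simp add: covar_def)
    then show ?thesis using nn r by (simp add: covar_le_def)
  qed
qed

lemma prob_block_parity: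
  assumes "S \<inter> T = {}" "S \<union> T = F" "S \<noteq> {}" "T \<noteq> {}"
  shows "measure_pmf.prob (block_pmf F c) {A. parity (A \<inter> S) = -1} = 1 / 2"
    and "measure_pmf.prob (block_pmf F c) {A. parity (A \<inter> T) = 1} = 1 / 2"
    and "measure_pmf.prob (block_pmf F c) ({A. parity (A \<inter> S) = -1} \<inter> {A. parity (A \<inter> T) = 1}) = (1 - c) / 4"
proof -
  let ?P = "measure_pmf (block_pmf F c)"
  have pm: "parity A = 1 \<or> parity A = -1" for A unfolding parity_def by (cases "even (card A)") auto
  \<comment> \<open>The indicators of sign product -1 and 1, as affine functions of parity. Their
    parity coefficients are -1/2 and 1/2, so the tilt contributes \<open>- c / 4\<close> to the
    joint probability.\<close>
  define f :: "nat set \<Rightarrow> real" where "f B = 1 / 2 + (- 1 / 2) * parity B" for B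
  define g :: "nat set \<Rightarrow> real" where "g B = 1 / 2 + (1 / 2) * parity B" for B
  have find: "indicat_real {A. parity (A \<inter> S) = -1} A = f (A \<inter> S)" for A
    using pm[of "A \<inter> S"] by (auto simp: f_def)
  have gind: "indicat_real {A. parity (A \<inter> T) = 1} A = g (A \<inter> T)" for A
    using pm[of "A \<inter> T"] by (auto simp: g_def)
  have fin: "finite S" "finite T" using assms F by auto
  have sub: "S \<subseteq> F" "S \<noteq> F" "T \<subseteq> F" "T \<noteq> F" using assms by auto
  have af: "avg S f = 1 / 2" and ag: "avg T g = 1 / 2"
    unfolding f_def[abs_def] g_def[abs_def] avg_add avg_scale using fin assms by (simp_all add: avg_parity)
  have fp: "(\<lambda>B. f B * parity B) = (\<lambda>B. 1 / 2 * parity B + (- 1 / 2))"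
    by (auto simp: f_def algebra_simps)
  have gp: "(\<lambda>B. g B * parity B) = (\<lambda>B. 1 / 2 * parity B + 1 / 2)"
    by (auto simp: g_def algebra_simps)
  have afp: "avg S (\<lambda>B. f B * parity B) = - 1 / 2" and agp: "avg T (\<lambda>B. g B * parity B) = 1 / 2"
    unfolding fp gp avg_add avg_scale using fin assms by (simp_all add: avg_parity)
  have "measure_pmf.prob (block_pmf F c) {A. parity (A \<inter> S) = -1} = (\<integral>A. indicat_real {A. parity (A \<inter> S) = -1} A \<partial>?P)" by simp
  then show "measure_pmf.prob (block_pmf F c) {A. parity (A \<inter> S) = -1} = 1 / 2"
    unfolding find integral_block_marginal[OF sub(1,2)] af .
  have "measure_pmf.prob (block_pmf F c) {A. parity (A \<inter> T) = 1} = (\<integral>A. indicat_real {A. parity (A \<inter> T) = 1} A \<partial>?P)" by simp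
  then show "measure_pmf.prob (block_pmf F c) {A. parity (A \<inter> T) = 1} = 1 / 2"
    unfolding gind integral_block_marginal[OF sub(3,4)] ag .
  have "measure_pmf.prob (block_pmf F c) ({A. parity (A \<inter> S) = -1} \<inter> {A. parity (A \<inter> T) = 1}) =
      (\<integral>A. indicat_real ({A. parity (A \<inter> S) = -1} \<inter> {A. parity (A \<inter> T) = 1}) A \<partial>?P)" by simp
  also have "\<dots> = (\<integral>A. f (A \<inter> S) * g (A \<inter> T) \<partial>?P)"
    by (intro Bochner_Integration.integral_cong refl) (simp only: indicator_inter_arith find gind)
  also have "\<dots> = (1 - c) / 4"
    unfolding integral_block_split[OF assms(1,2)] af ag afp agp by (simp add: field_simps)
  finally show "measure_pmf.prob (block_pmf F c) ({A. parity (A \<inter> S) = -1} \<inter> {A. parity (A \<inter> T) = 1}) = (1 - c) / 4" .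
qed

end

subsection \<open>Binary digits of a uniform variable\<close>

text \<open>Digits are counted from 0, exist for every real and have period 1, which makes doubling
  a shift. Dyadic rationals receive their terminating expansion.\<close>

definition digit :: "nat \<Rightarrow> real \<Rightarrow> bool" where
  "digit j x \<longleftrightarrow> odd \<lfloor>2 ^ Suc j * x\<rfloor>"

definition from_digits :: "(nat \<Rightarrow> bool) \<Rightarrow> real" where
  "from_digits b = (\<Sum>j. of_bool (b j) * (1 / 2) ^ Suc j)"

definition coin_seq :: "(nat \<Rightarrow> bool) measure" where
  "coin_seq = PiM UNIV (\<lambda>_. measure_pmf (bernoulli_pmf (1 / 2)))"

lemma digit_measurable [measurable]: "Measurable.pred borel (digit j)"
  unfolding digit_def[abs_def] by measurable

lemma digit_Suc: "digit (Suc j) x = digit j (2 * x)"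
  by (simp add: digit_def algebra_simps)

lemma digit_minus_1: "digit j (x - 1) = digit j x"
proof -
  have "2 ^ Suc j * (x - 1) = 2 ^ Suc j * x - real_of_int (2 ^ Suc j)" by (simp add: algebra_simps)
  then have "\<lfloor>2 ^ Suc j * (x - 1)\<rfloor> = \<lfloor>2 ^ Suc j * x\<rfloor> - 2 ^ Suc j"
    by (simp only: floor_diff_of_int)
  then show ?thesis unfolding digit_def by simp
qed

lemma digit_0:
  assumes "0 \<le> x" "x < 1"
  shows "digit 0 x \<longleftrightarrow> 1 / 2 \<le> x"
proof (cases "1 / 2 \<le> x")
  case True
  with assms have "\<lfloor>2 * x\<rfloor> = 1" by (intro floor_unique) auto
  with True show ?thesis by (simp add: digit_def)
next
  case False
  with assms have "\<lfloor>2 * x\<rfloor> = 0" by (intro floor_unique) auto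
  with False show ?thesis by (simp add: digit_def)
qed

lemma floor_double: "\<lfloor>2 * y\<rfloor> = 2 * \<lfloor>y\<rfloor> + of_bool (odd \<lfloor>2 * y\<rfloor>)" for y :: real
proof -
  have "\<lfloor>2 * y\<rfloor> = 2 * \<lfloor>y\<rfloor> \<or> \<lfloor>2 * y\<rfloor> = 2 * \<lfloor>y\<rfloor> + 1" by linarith
  then show ?thesis by auto
qed

text \<open>Doubling \<open>y\<close> doubles its floor and adds the next digit, so partial sums of
  the expansion are floors on the scale \<open>2 ^ n\<close>.\<close>

lemma sum_digits:
  assumes "0 \<le> x" "x < 1"
  shows "(\<Sum>j<n. of_bool (digit j x) * (1 / 2) ^ Suc j) = (of_int \<lfloor>2 ^ n * x\<rfloor> / 2 ^ n :: real)"
proof (induction n)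
  case 0
  have "\<lfloor>x\<rfloor> = 0" using assms by (intro floor_unique) auto
  then show ?case by simp
next
  case (Suc n)
  have "\<lfloor>2 ^ Suc n * x\<rfloor> = 2 * \<lfloor>2 ^ n * x\<rfloor> + of_bool (digit n x)"
    using floor_double[of "2 ^ n * x"] by (simp add: digit_def mult.assoc)
  then have "real_of_int \<lfloor>2 ^ Suc n * x\<rfloor> = 2 * of_int \<lfloor>2 ^ n * x\<rfloor> + of_bool (digit n x)"
    by (simp del: power_Suc)
  then show ?case using Suc by (simp add: field_simps power_one_over)
qed

lemma from_digits_digit:
  assumes "0 \<le> x" "x < 1"
  shows "from_digits (\<lambda>j. digit j x) = x"
proof -
  have "(\<lambda>n. of_int \<lfloor>2 ^ n * x\<rfloor> / 2 ^ n :: real) \<longlonglongrightarrow> x"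
  proof (rule LIM_zero_cancel, rule Lim_null_comparison)
    show "(\<lambda>n. (1 / 2) ^ n :: real) \<longlonglongrightarrow> 0" by (rule LIMSEQ_realpow_zero) auto
    show "\<forall>\<^sub>F n in sequentially. norm (of_int \<lfloor>2 ^ n * x\<rfloor> / 2 ^ n - x) \<le> (1 / 2) ^ n"
    proof (rule always_eventually, rule allI)
      fix n :: nat
      have "\<bar>of_int \<lfloor>2 ^ n * x\<rfloor> - 2 ^ n * x\<bar> \<le> 1" by linarith
      moreover have "of_int \<lfloor>2 ^ n * x\<rfloor> / 2 ^ n - x = (of_int \<lfloor>2 ^ n * x\<rfloor> - 2 ^ n * x) / 2 ^ n"
        by (simp add: field_simps)
      ultimately show "norm (of_int \<lfloor>2 ^ n * x\<rfloor> / 2 ^ n - x) \<le> (1 / 2) ^ n"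
        by (simp add: power_one_over divide_right_mono)
    qed
  qed
  then have "(\<lambda>j. of_bool (digit j x) * (1 / 2) ^ Suc j) sums x"
    unfolding sums_def by (simp only: sum_digits[OF assms])
  then show ?thesis unfolding from_digits_def by (rule sums_unique[symmetric])
qed

lemma from_digits_measurable:
  assumes "\<And>j. Measurable.pred M (\<lambda>x. b x j)"
  shows "(\<lambda>x. from_digits (b x)) \<in> borel_measurable M"
proof -
  note [measurable] = assms
  show ?thesis unfolding from_digits_def by measurable
qed

section \<open>Digits of a uniform variable are fair coins\<close>

lemma emeasure_bernoulli_half:
  "emeasure (measure_pmf (bernoulli_pmf (1 / 2))) A = ennreal ((of_bool (True \<in> A) + of_bool (False \<in> A)) / 2)"
proof -
  have "emeasure (measure_pmf (bernoulli_pmf (1 / 2))) A = (\<Sum>x\<in>A. pmf (bernoulli_pmf (1 / 2)) x)"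
    by (subst emeasure_measure_pmf_finite) auto
  also have "(\<Sum>x\<in>A. pmf (bernoulli_pmf (1 / 2)) x) = (of_bool (True \<in> A) + of_bool (False \<in> A)) / 2"
  proof -
    have "A = {} \<or> A = {True} \<or> A = {False} \<or> A = {True, False}" by (auto; metis (full_types))
    then show ?thesis by auto
  qed
  finally show ?thesis .
qed

lemma card_bool_set: "real (card A) = of_bool (True \<in> A) + of_bool (False \<in> A)" for A :: "bool set"
proof -
  have "A = {} \<or> A = {True} \<or> A = {False} \<or> A = {True, False}" by (auto; metis (full_types))
  then show ?thesis by (elim disjE) simp_all
qed

lemma emeasure_lborel_double:
  assumes "S \<in> sets borel"
  shows "emeasure lborel {x::real. 2 * x - t \<in> S} = emeasure lborel S / 2"
proof -
  have "emeasure lborel S = emeasure (density (distr lborel borel (\<lambda>x. - t + 2 * x)) (\<lambda>_. ennreal \<bar>2\<bar>)) S"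
    using lborel_real_affine[of 2 "- t"] by simp
  also have "\<dots> = 2 * emeasure lborel {x::real. 2 * x - t \<in> S}"
    using assms by (simp add: emeasure_density_const emeasure_distr vimage_def)
  finally have *: "emeasure lborel S = 2 * emeasure lborel {x::real. 2 * x - t \<in> S}" .
  show ?thesis unfolding * by (subst mult.commute) (simp add: mult_divide_eq_ennreal)
qed

text \<open>Induction on the leading digit. Prescribing it as \<open>v\<close> selects a half of the
  interval, which \<open>2 * x - v\<close> maps onto \<open>{0..<1}\<close> with all digits shifted
  by one. Each admissible \<open>v\<close> thus contributes half the measure for the remaining
  digits.\<close>

lemma emeasure_digits:
  "emeasure lborel {x\<in>{0..<1}. \<forall>j<n. digit j x \<in> A j} = (\<Prod>j<n. emeasure (measure_pmf (bernoulli_pmf (1 / 2))) (A j))"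
proof (induction n arbitrary: A)
  case 0
  have "{x\<in>{0..<1}. \<forall>j<0. digit j x \<in> A j} = {0..<1}" by auto
  then show ?case by simp
next
  case (Suc n)
  define S where "S = {x\<in>{0..<1}. \<forall>j<n. digit j x \<in> A (Suc j)}"
  have [measurable]: "S \<in> sets borel" unfolding S_def by measurable
  define V where "V v = {x::real. 2 * x - of_bool v \<in> S}" for v
  have [measurable]: "V v \<in> sets borel" for v unfolding V_def by measurable
  have split: "{x\<in>{0..<1}. \<forall>j<Suc n. digit j x \<in> A j} = (\<Union>v\<in>A 0. V v)"
  proof (intro set_eqI)
    fix x :: real
    have all: "(\<forall>j<Suc n. digit j x \<in> A j) \<longleftrightarrow> digit 0 x \<in> A 0 \<and> (\<forall>j<n. digit j (2 * x) \<in> A (Suc j))"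
      by (simp add: All_less_Suc2 digit_Suc)
    have V: "x \<in> V v \<longleftrightarrow> 0 \<le> x \<and> x < 1 \<and> digit 0 x = v \<and> (\<forall>j<n. digit j (2 * x) \<in> A (Suc j))" for v
    proof (cases v)
      case True
      have "x \<in> V v \<longleftrightarrow> 0 \<le> 2 * x - 1 \<and> 2 * x - 1 < 1 \<and> (\<forall>j<n. digit j (2 * x) \<in> A (Suc j))"
        using True by (simp add: V_def S_def digit_minus_1)
      also have "\<dots> \<longleftrightarrow> 0 \<le> x \<and> x < 1 \<and> 1 / 2 \<le> x \<and> (\<forall>j<n. digit j (2 * x) \<in> A (Suc j))"
        by auto
      finally show ?thesis using digit_0[of x] True by blast
    next
      case False
      have "x \<in> V v \<longleftrightarrow> 0 \<le> 2 * x \<and> 2 * x < 1 \<and> (\<forall>j<n. digit j (2 * x) \<in> A (Suc j))"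
        using False by (simp add: V_def S_def)
      also have "\<dots> \<longleftrightarrow> 0 \<le> x \<and> x < 1 \<and> \<not> 1 / 2 \<le> x \<and> (\<forall>j<n. digit j (2 * x) \<in> A (Suc j))"
        by auto
      finally show ?thesis using digit_0[of x] False by blast
    qed
    show "x \<in> {x\<in>{0..<1}. \<forall>j<Suc n. digit j x \<in> A j} \<longleftrightarrow> x \<in> (\<Union>v\<in>A 0. V v)"
      by (simp only: mem_Collect_eq atLeastLessThan_iff all V UN_iff) blast
  qed
  have half: "emeasure lborel (V v) = emeasure lborel S / 2" for v
    unfolding V_def by (rule emeasure_lborel_double) simp
  have dis: "disjoint_family_on V (A 0)"
    unfolding disjoint_family_on_def
  proof (intro ballI impI)
    fix v w :: bool assume "v \<noteq> w"
    show "V v \<inter> V w = {}"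
    proof (rule ccontr)
      assume "V v \<inter> V w \<noteq> {}"
      then obtain x where "2 * x - of_bool v \<in> S" "2 * x - of_bool w \<in> S" by (auto simp: V_def)
      with \<open>v \<noteq> w\<close> show False by (cases v; cases w) (auto simp: S_def)
    qed
  qed
  have "emeasure lborel (\<Union>v\<in>A 0. V v) = (\<Sum>v\<in>A 0. emeasure lborel (V v))"
    by (rule sum_emeasure[symmetric]) (use dis in auto)
  also have "\<dots> = of_nat (card (A 0)) * (emeasure lborel S / 2)" by (simp add: half)
  also have "\<dots> = emeasure (measure_pmf (bernoulli_pmf (1 / 2))) (A 0) * emeasure lborel S"
  proof -

    have "ennreal (real (card (A 0)) / 2) = of_nat (card (A 0)) / 2"
      by (simp add: divide_ennreal[symmetric] ennreal_of_nat_eq_real_of_nat)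
    then show ?thesis unfolding emeasure_bernoulli_half card_bool_set[symmetric]
      by (metis ennreal_times_divide mult.commute)
  qed
  finally show ?case
    unfolding split using Suc[of "\<lambda>j. A (Suc j)"]
    by (simp add: S_def prod.lessThan_Suc_shift del: prod.lessThan_Suc)
qed

text \<open>The endpoint is a null set. It is removed because all digits of 1 vanish, so the
  expansion would return 0.\<close>

lemma emeasure_uniform01:
  assumes "B \<in> sets borel"
  shows "emeasure (uniform_measure lborel {0..1::real}) B = emeasure lborel ({0..<1} \<inter> B)"
proof -
  have "emeasure (uniform_measure lborel {0..1::real}) B = emeasure lborel ({0..1} \<inter> B)"
    using assms by (simp add: divide_ennreal_def)
  also have "\<dots> = emeasure lborel ({0..<1} \<inter> B)"
    using assms AE_lborel_singleton[of "1::real"] by (intro emeasure_eq_AE) auto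
  finally show ?thesis .
qed

lemma prob_space_uniform01: "prob_space (uniform_measure lborel {0..1::real})"
  by (intro prob_space_uniform_measure) auto

lemma prob_space_coin_seq: "prob_space coin_seq"
  unfolding coin_seq_def by (intro prob_space_PiM prob_space_measure_pmf)

lemma digits_measurable: "(\<lambda>x j. digit j x) \<in> borel \<rightarrow>\<^sub>M coin_seq"
  unfolding coin_seq_def by (rule measurable_PiM_single') (auto simp: space_PiM)

lemma distr_digits: "distr (uniform_measure lborel {0..1}) coin_seq (\<lambda>x j. digit j x) = coin_seq"
proof -
  interpret U: prob_space "uniform_measure lborel {0..1::real}" by (rule prob_space_uniform01)
  interpret C: prob_space coin_seq by (rule prob_space_coin_seq)
  have dm: "(\<lambda>x j. digit j x) \<in> uniform_measure lborel {0..1} \<rightarrow>\<^sub>M coin_seq"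
    using digits_measurable by simp
  interpret D: prob_space "distr (uniform_measure lborel {0..1}) coin_seq (\<lambda>x j. digit j x)"
    by (rule U.prob_space_distr[OF dm])
  show ?thesis
  proof (rule measure_eqI_PiM_infinite)
    show "sets (distr (uniform_measure lborel {0..1}) coin_seq (\<lambda>x j. digit j x)) =
        sets (PiM UNIV (\<lambda>_. measure_pmf (bernoulli_pmf (1 / 2))))" by (simp add: coin_seq_def)
    show "sets coin_seq = sets (PiM UNIV (\<lambda>_. measure_pmf (bernoulli_pmf (1 / 2))))" by (simp add: coin_seq_def)
    show "finite_measure (distr (uniform_measure lborel {0..1}) coin_seq (\<lambda>x j. digit j x))"
      by (rule D.finite_measure_axioms)
  next
    fix A :: "nat \<Rightarrow> bool set" and J :: "nat set"
    assume J: "finite J"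
    \<comment> \<open>The constraints are padded with \<open>UNIV\<close> to an initial segment of
      digits; inserting 0 keeps \<open>Max\<close> defined for empty \<open>J\<close>.\<close>
    define n where "n = Max (insert 0 J)"
    define B where "B j = (if j \<in> J then A j else UNIV)" for j
    have Jn: "J \<subseteq> {..n}" using J by (auto simp: n_def)
    let ?M = "\<lambda>_::nat. measure_pmf (bernoulli_pmf (1 / 2))"
    let ?E = "prod_emb UNIV ?M J (Pi\<^sub>E J A)"
    have E: "?E = {b. \<forall>j<Suc n. b j \<in> B j}"
      using subsetD[OF Jn] by (auto simp: prod_emb_def PiE_iff less_Suc_eq_le B_def)
    have Es: "?E \<in> sets coin_seq" unfolding coin_seq_def using J by (intro sets_PiM_I) auto
    have "emeasure (distr (uniform_measure lborel {0..1}) coin_seq (\<lambda>x j. digit j x)) ?E =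
        emeasure (uniform_measure lborel {0..1}) {x. \<forall>j<Suc n. digit j x \<in> B j}"
      by (subst emeasure_distr[OF dm Es]) (simp add: E vimage_def)
    also have "\<dots> = emeasure lborel {x\<in>{0..<1}. \<forall>j<Suc n. digit j x \<in> B j}"
      by (subst emeasure_uniform01) (auto intro!: arg_cong[where f="emeasure lborel"])
    also have "\<dots> = (\<Prod>j\<in>{..<Suc n}. emeasure (?M j) (B j))" by (rule emeasure_digits)
    also have "\<dots> = (\<Prod>j\<in>J. emeasure (?M j) (A j))"
      using Jn by (intro prod.mono_neutral_cong_right)
        (auto simp: B_def less_Suc_eq_le measure_pmf.emeasure_space_1[simplified])
    also have "\<dots> = emeasure coin_seq ?E"
      unfolding coin_seq_def using J
      by (subst emeasure_PiM_emb) (auto simp: prob_space_measure_pmf)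
    finally show "emeasure (distr (uniform_measure lborel {0..1}) coin_seq (\<lambda>x j. digit j x)) ?E = emeasure coin_seq ?E" .
  qed
qed

lemma from_digits_measurable_coin_seq: "from_digits \<in> borel_measurable coin_seq"
  unfolding coin_seq_def
  using from_digits_measurable[where M="PiM UNIV (\<lambda>_. measure_pmf (bernoulli_pmf (1 / 2)))" and b="\<lambda>x. x"]
  by simp

lemma AE_uniform01: "AE x in uniform_measure lborel {0..1::real}. 0 \<le> x \<and> x < 1"
proof -
  have "AE x in lborel. x \<in> {0..1} \<longrightarrow> 0 \<le> x \<and> x < (1::real)"
    using AE_lborel_singleton[of "1::real"] by eventually_elim auto
  then show ?thesis by (subst AE_uniform_measure) auto
qed

text \<open>\<open>coin_seq\<close> is itself the law of the digits of a uniform variable, and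
  summing these digits returns that variable almost surely.\<close>

lemma distr_from_digits: "distr coin_seq lborel from_digits = uniform_measure lborel {0..1}"
proof -
  have dm: "(\<lambda>x j. digit j x) \<in> uniform_measure lborel {0..1} \<rightarrow>\<^sub>M coin_seq"
    using digits_measurable by simp
  have fm: "from_digits \<in> coin_seq \<rightarrow>\<^sub>M lborel" using from_digits_measurable_coin_seq by simp
  have "distr coin_seq lborel from_digits =
      distr (distr (uniform_measure lborel {0..1}) coin_seq (\<lambda>x j. digit j x)) lborel from_digits"
    by (simp only: distr_digits)
  also have "\<dots> = distr (uniform_measure lborel {0..1}) lborel (from_digits \<circ> (\<lambda>x j. digit j x))"
    by (rule distr_distr[OF fm dm])
  also have "\<dots> = distr (uniform_measure lborel {0..1}) (uniform_measure lborel {0..1}) (\<lambda>x. x)"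
  proof (rule distr_cong_AE)
    show "AE x in uniform_measure lborel {0..1}. (from_digits \<circ> (\<lambda>x j. digit j x)) x = x"
      using AE_uniform01 by eventually_elim (simp add: from_digits_digit)
  qed (use measurable_comp[OF dm fm] in auto)
  finally show ?thesis by (simp add: distr_id)
qed

text \<open>Sequences that are eventually all ones are not recovered. Representing coins as digits
  of a uniform variable hides this null set, since digits of a point of \<open>{0..<1}\<close>
  always are.\<close>

lemma AE_digit_from_digits: "AE b in coin_seq. \<forall>j. digit j (from_digits b) = b j"
proof -
  have dm: "(\<lambda>x j. digit j x) \<in> uniform_measure lborel {0..1} \<rightarrow>\<^sub>M coin_seq"
    using digits_measurable by simp
  note [measurable] = from_digits_measurable_coin_seq
  have [measurable]: "Measurable.pred coin_seq (\<lambda>b. b j)" for j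
    unfolding coin_seq_def by measurable
  have "AE b in distr (uniform_measure lborel {0..1}) coin_seq (\<lambda>x j. digit j x). \<forall>j. digit j (from_digits b) = b j"
  proof (subst AE_distr_iff[OF dm])
    show "{b \<in> space coin_seq. \<forall>j. digit j (from_digits b) = b j} \<in> sets coin_seq" by measurable
    show "AE x in uniform_measure lborel {0..1}. \<forall>j. digit j (from_digits (\<lambda>j. digit j x)) = digit j x"
      using AE_uniform01 by eventually_elim (simp add: from_digits_digit)
  qed
  then show ?thesis by (simp only: distr_digits)
qed

subsection \<open>The random field\<close>

lemma zd_norm_axis: "zd_norm (axis u x :: int ^ 'd::finite) = \<bar>of_int x\<bar>"
proof -
  have "(\<Sum>v\<in>UNIV. (real_of_int ((axis u x :: int ^ 'd) $ v))\<^sup>2) = (\<Sum>v\<in>UNIV. if v = u then (of_int x)\<^sup>2 else 0)"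
    by (intro sum.cong) (auto simp: axis_def)
  then show ?thesis by (simp add: zd_norm_def)
qed

lemma abs_component_le_zd_norm: "\<bar>of_int (k $ u)\<bar> \<le> zd_norm k"
proof -
  have "(real_of_int (k $ u))\<^sup>2 \<le> (\<Sum>v\<in>UNIV. (real_of_int (k $ v))\<^sup>2)"
    by (rule member_le_sum) auto
  then show ?thesis unfolding zd_norm_def by (metis real_sqrt_abs real_sqrt_le_mono)
qed

lemma zd_norm_minus: "zd_norm (- k) = zd_norm k"
  by (simp add: zd_norm_def)

text \<open>Discrete connectedness: without a switch between neighbours, the part containing 0
  spreads by induction over all of \<open>{..N}\<close>.\<close>

lemma exists_adjacent_split:
  assumes "A \<union> B = {..N::nat}" "A \<noteq> {}" "B \<noteq> {}" "A \<inter> B = {}"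
  shows "\<exists>i. i \<in> A \<and> Suc i \<in> B \<or> i \<in> B \<and> Suc i \<in> A"
proof (rule ccontr)
  assume no: "\<not> ?thesis"
  have all: "{..N} \<subseteq> C" if "0 \<in> C" "C = A \<or> C = B" for C
  proof
    fix i assume "i \<in> {..N}"
    then show "i \<in> C"
    proof (induction i)
      case (Suc i)
      then have "i \<in> C" by simp
      then show ?case using no that(2) Suc.prems assms(1) by blast
    qed (use that in simp)
  qed
  have "0 \<in> A \<or> 0 \<in> B" using assms(1) by auto
  then show False using all[of A] all[of B] assms by blast
qed

locale block_field =
  fixes N :: nat and c :: "nat \<Rightarrow> real" and u0 :: "'d::finite"
  assumes N: "1 \<le> N" and c_range: "\<And>n. 1 \<le> n \<Longrightarrow> c n \<in> {0..1}"
    and c_mono: "\<And>m n. 1 \<le> n \<Longrightarrow> n \<le> m \<Longrightarrow> c m \<le> c n"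
begin

text \<open>The block \<^term>\<open>(m, k)\<close> has its bits at \<^term>\<open>N + 1\<close> sites in arithmetic progression from
  \<^term>\<open>k\<close> with step \<^term>\<open>m + 1\<close>, so it correlates sites at distance up to \<^term>\<open>m + 1\<close> only.\<close>

definition block :: "nat \<times> (int ^ 'd) \<Rightarrow> nat set pmf" where
  "block b = block_pmf {..N} (c (Suc (fst b)))"

definition site :: "nat \<times> (int ^ 'd) \<Rightarrow> nat \<Rightarrow> int ^ 'd" where
  "site b i = snd b + axis u0 (int (i * Suc (fst b)))"

definition P :: "(nat \<times> (int ^ 'd) \<Rightarrow> nat set) measure" where
  "P = PiM UNIV (\<lambda>b. measure_pmf (block b))"

text \<open>Digit \<open>m * (N + 1) + i\<close> of site \<open>k\<close> is bit \<open>i\<close> of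
  the block with first component \<open>m\<close> whose \<open>i\<close>-th site is
  \<open>k\<close>. Division by \<open>N + 1\<close> thus enumerates every bit located at
  \<open>k\<close> exactly once.\<close>

definition bit_address :: "int ^ 'd \<Rightarrow> nat \<Rightarrow> (nat \<times> (int ^ 'd)) \<times> nat" where
  "bit_address k j = ((j div Suc N, k - axis u0 (int ((j mod Suc N) * Suc (j div Suc N)))), j mod Suc N)"

definition block_bit :: "(nat \<times> (int ^ 'd)) \<times> nat \<Rightarrow> (nat \<times> (int ^ 'd) \<Rightarrow> nat set) \<Rightarrow> bool" where
  "block_bit l w \<longleftrightarrow> snd l \<in> w (fst l)"

definition field :: "int ^ 'd \<Rightarrow> (nat \<times> (int ^ 'd) \<Rightarrow> nat set) \<Rightarrow> real" where
  "field k w = from_digits (\<lambda>j. block_bit (bit_address k j) w)"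

sublocale P: prob_space P
  unfolding P_def by (intro prob_space_PiM prob_space_measure_pmf)

lemma space_P [simp]: "space P = UNIV"
  by (auto simp: P_def space_PiM)

lemma c_Suc: "0 \<le> c (Suc m)" "c (Suc m) \<le> 1"
  using c_range[of "Suc m"] by auto

lemma site_bit_address: "site (fst (bit_address k j)) (snd (bit_address k j)) = k"
  by (simp add: site_def bit_address_def)

lemma bit_address_le: "snd (bit_address k j) \<le> N"
  unfolding bit_address_def by (simp add: less_Suc_eq_le[symmetric])

lemma bit_address_inj: "bit_address k j = bit_address k' j' \<longleftrightarrow> k = k' \<and> j = j'"
proof
  assume eq: "bit_address k j = bit_address k' j'"
  then have "k = k'" by (metis site_bit_address)
  moreover have "j = j'"
    using eq unfolding bit_address_def by (metis Pair_inject div_mult_mod_eq)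
  ultimately show "k = k' \<and> j = j'" by simp
qed auto

lemma bit_address_mult_add:
  assumes "i \<le> N"
  shows "bit_address k (m * Suc N + i) = ((m, k - axis u0 (int (i * Suc m))), i)"
proof -
  have "(m * Suc N + i) div Suc N = m" "(m * Suc N + i) mod Suc N = i"
    using assms by (simp_all add: div_mult_self3 del: mult_Suc_right)
  then show ?thesis by (simp add: bit_address_def del: mult_Suc_right)
qed

lemma site_inj: "inj (site b)"
proof (rule injI)
  fix i i' assume "site b i = site b i'"
  then have "axis u0 (int (i * Suc (fst b))) = (axis u0 (int (i' * Suc (fst b))) :: int ^ 'd)"
    by (simp add: site_def)
  then show "i = i'" by (auto simp: axis_eq_axis simp del: mult_Suc_right)
qed

section \<open>Independence and law of the bits\<close>

lemma block_bit_measurable [measurable]: "Measurable.pred P (block_bit l)"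
proof -
  have "(\<lambda>w. w (fst l)) \<in> P \<rightarrow>\<^sub>M measure_pmf (block (fst l))"
    unfolding P_def by (rule measurable_component_singleton) simp
  then have "(\<lambda>w. snd l \<in> w (fst l)) \<in> P \<rightarrow>\<^sub>M count_space UNIV"
    by (rule measurable_compose) simp
  then show ?thesis by (simp add: block_bit_def[abs_def])
qed

lemma field_measurable [measurable]: "field k \<in> borel_measurable P"
  unfolding field_def[abs_def] by (rule from_digits_measurable) simp

text \<open>The probability factors over the independent blocks. In each of them \<open>J\<close>
  misses at least one bit, so the tilt is invisible and the bits are fair.\<close>

lemma prob_block_bits:
  assumes "finite J" "\<And>b. {i. (b, i) \<in> J} \<subset> {..N}"
  shows "P.prob {w. \<forall>l\<in>J. block_bit l w} = (1 / 2) ^ card J"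
proof -
  define Jb where "Jb b = {i. (b, i) \<in> J}" for b
  have JS: "J = Sigma (fst ` J) Jb" by (force simp: Jb_def)
  have finb: "finite (Jb b)" for b
    using assms(2)[of b] finite_subset[of _ "{..N}"] by (auto simp: Jb_def)
  interpret PP: product_prob_space "\<lambda>b. measure_pmf (block b)" UNIV ..
  have "{w. \<forall>l\<in>J. block_bit l w} = PP.emb UNIV (fst ` J) (Pi\<^sub>E (fst ` J) (\<lambda>b. {A. Jb b \<subseteq> A}))"
    by (force simp: prod_emb_def PiE_iff block_bit_def Jb_def)
  then have "P.prob {w. \<forall>l\<in>J. block_bit l w} = (\<Prod>b\<in>fst ` J. measure_pmf.prob (block b) {A. Jb b \<subseteq> A})"
    unfolding P_def using assms(1) by (simp add: PP.measure_PiM_emb)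
  also have "\<dots> = (\<Prod>b\<in>fst ` J. (1 / 2) ^ card (Jb b))"
  proof (intro prod.cong refl)
    fix b
    show "measure_pmf.prob (block b) {A. Jb b \<subseteq> A} = (1 / 2) ^ card (Jb b)"
      unfolding block_def using assms(2)[of b] c_Suc
      by (intro prob_block_superset) (auto simp: Jb_def)
  qed
  also have "\<dots> = (1 / 2) ^ (\<Sum>b\<in>fst ` J. card (Jb b))" by (rule power_sum[symmetric])
  also have "(\<Sum>b\<in>fst ` J. card (Jb b)) = card J"
    using assms(1) finb by (subst (2) JS) simp
  finally show ?thesis .
qed

text \<open>The events that single bits are set determine everything: one event alone is
  intersection-stable and generates the sigma-algebra of its bit. \<open>I\<close> may be infinite,
  as independence only tests finite subfamilies.\<close>

lemma indep_block_bits: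
  assumes inj: "inj_on a I" and L: "\<And>b. {i. (b, i) \<in> a ` I} \<subset> {..N}"
  shows "P.indep_vars (\<lambda>_. measure_pmf (bernoulli_pmf (1 / 2))) (\<lambda>l. block_bit (a l)) I"
proof -
  define E where "E l = {{w. block_bit (a l) w}}" for l
  have sub: "{i. (b, i) \<in> a ` J} \<subset> {..N}" if "J \<subseteq> I" for J b
  proof (rule order_le_less_trans[OF _ L])
    show "{i. (b, i) \<in> a ` J} \<subseteq> {i. (b, i) \<in> a ` I}" using that by blast
  qed
  have E_events: "{w. block_bit l w} \<in> P.events" for l
    using block_bit_measurable[of l] by (simp add: pred_def)
  have "P.indep_sets E I"
  proof (rule P.indep_setsI)
    show "E l \<subseteq> P.events" for l using E_events by (simp add: E_def)
    fix A J assume J: "J \<noteq> {}" "J \<subseteq> I" "finite J" "\<forall>j\<in>J. A j \<in> E j"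
    then have A: "\<And>j. j \<in> J \<Longrightarrow> A j = {w. block_bit (a j) w}" by (auto simp: E_def)
    have single: "P.prob (A j) = 1 / 2" if "j \<in> J" for j
    proof -
      have "{j} \<subseteq> I" using that J(2) by auto
      from prob_block_bits[OF _ sub[OF this]] show ?thesis using A[OF that] by simp
    qed
    have "(\<Inter>j\<in>J. A j) = {w. \<forall>l\<in>a ` J. block_bit l w}" using A by auto
    then have "P.prob (\<Inter>j\<in>J. A j) = (1 / 2) ^ card (a ` J)"
      using prob_block_bits[OF finite_imageI[OF J(3)] sub[OF J(2)]] by simp
    also have "card (a ` J) = card J" using card_image[OF inj_on_subset[OF inj J(2)]] .
    also have "(1 / 2) ^ card J = (\<Prod>j\<in>J. 1 / 2 :: real)" by simp
    also have "\<dots> = (\<Prod>j\<in>J. P.prob (A j))" using single by (intro prod.cong) auto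
    finally show "P.prob (\<Inter>j\<in>J. A j) = (\<Prod>j\<in>J. P.prob (A j))" .
  qed
  then have ind: "P.indep_sets (\<lambda>l. sigma_sets (space P) (E l)) I"
    by (rule P.indep_sets_sigma) (auto simp: E_def Int_stable_def)
  show ?thesis
    unfolding P.indep_vars_def2
  proof (intro conjI ballI)
    show "block_bit (a l) \<in> P \<rightarrow>\<^sub>M measure_pmf (bernoulli_pmf (1 / 2))" for l
      using block_bit_measurable[of "a l"] by (simp add: measurable_def)
    show "P.indep_sets (\<lambda>l. {block_bit (a l) -` A \<inter> space P |A. A \<in> sets (measure_pmf (bernoulli_pmf (1 / 2)))}) I"
    proof (rule P.indep_sets_mono_sets[OF ind])
      fix l
      interpret S: sigma_algebra "space P" "sigma_sets (space P) (E l)"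
        by (rule sigma_algebra_sigma_sets) (auto simp: E_def)
      have 1: "{w. block_bit (a l) w} \<in> sigma_sets (space P) (E l)" by (auto simp: E_def)
      show "{block_bit (a l) -` A \<inter> space P |A. A \<in> sets (measure_pmf (bernoulli_pmf (1 / 2)))} \<subseteq> sigma_sets (space P) (E l)"
      proof safe
        fix A :: "bool set"
        have "block_bit (a l) -` A \<inter> space P =
          (if True \<in> A then {w. block_bit (a l) w} else {}) \<union> (if False \<in> A then space P - {w. block_bit (a l) w} else {})"
        proof (rule set_eqI)
          fix w
          show "w \<in> block_bit (a l) -` A \<inter> space P \<longleftrightarrow> w \<in> (if True \<in> A then {w. block_bit (a l) w} else {}) \<union>
              (if False \<in> A then space P - {w. block_bit (a l) w} else {})"
            by (cases "block_bit (a l) w") simp_all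
        qed
        also have "\<dots> \<in> sigma_sets (space P) (E l)"
          using 1 S.compl_sets[OF 1] S.empty_sets by (intro S.Un) simp_all
        finally show "block_bit (a l) -` A \<inter> space P \<in> sigma_sets (space P) (E l)" .
      qed
    qed
  qed
qed

text \<open>A block occupies \<open>N + 1\<close> distinct sites, so at most \<open>N\<close> sites
  cannot carry all of its bits. This is the counting argument behind tuplewise independence.\<close>

lemma proper_addresses:
  assumes K: "finite K" "card K \<le> N"
  shows "{i. \<exists>k\<in>K. \<exists>j. (b, i) = bit_address k j} \<subset> {..N}" (is "?I \<subset> _")
proof -
  have le: "i \<le> N \<and> site b i \<in> K" if "k \<in> K" "(b, i) = bit_address k j" for i k j
    using that(1) bit_address_le[of k j] site_bit_address[of k j] by (simp flip: that(2))
  have "?I \<noteq> {..N}"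
  proof
    assume "?I = {..N}"
    then have "site b ` {..N} \<subseteq> K" using le by blast
    then have "card (site b ` {..N}) \<le> card K" by (rule card_mono[OF K(1)])
    moreover have "card (site b ` {..N}) = Suc N"
      using site_inj[of b] by (subst card_image) (auto intro: inj_on_subset)
    ultimately show False using K(2) by simp
  qed
  with le show ?thesis by blast
qed

lemma indep_site_bits:
  assumes K: "finite K" "card K \<le> N"
  shows "P.indep_vars (\<lambda>_. measure_pmf (bernoulli_pmf (1 / 2)))
     (\<lambda>(k, j). block_bit (bit_address k j)) (K \<times> UNIV)"
proof -
  define \<phi> where "\<phi> = (\<lambda>(k, j). bit_address k j)"
  have inj: "inj_on \<phi> (K \<times> UNIV)"
    by (auto simp: inj_on_def \<phi>_def bit_address_inj)
  have "{i. (b, i) \<in> \<phi> ` (K \<times> UNIV)} = {i. \<exists>k\<in>K. \<exists>j. (b, i) = bit_address k j}" for b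
    by (auto simp: \<phi>_def image_iff)
  then have "{i. (b, i) \<in> \<phi> ` (K \<times> UNIV)} \<subset> {..N}" for b
    using proper_addresses[OF K, of b] by simp
  from indep_block_bits[OF inj this] show ?thesis
    by (simp add: \<phi>_def split_beta')
qed

lemma indep_field:
  assumes K: "finite K" "card K \<le> N"
  shows "P.indep_vars (\<lambda>_. borel) field K"
proof -
  let ?B = "measure_pmf (bernoulli_pmf (1 / 2))"
  have "P.indep_vars (\<lambda>k. PiM ({k} \<times> UNIV) (\<lambda>_. ?B))
      (\<lambda>k w. restrict (\<lambda>i. (case i of (k, j) \<Rightarrow> block_bit (bit_address k j)) w) ({k} \<times> UNIV)) K"
    by (rule P.indep_vars_restrict[OF indep_site_bits[OF K]]) (auto simp: disjoint_family_on_def)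
  then have "P.indep_vars (\<lambda>_. borel) (\<lambda>k w. (\<lambda>y. from_digits (\<lambda>j. y (k, j)))
      (restrict (\<lambda>i. (case i of (k, j) \<Rightarrow> block_bit (bit_address k j)) w) ({k} \<times> UNIV))) K"
  proof (rule P.indep_vars_compose2)
    fix k
    show "(\<lambda>y. from_digits (\<lambda>j. y (k, j))) \<in> PiM ({k} \<times> UNIV) (\<lambda>_. ?B) \<rightarrow>\<^sub>M borel"
    proof (rule from_digits_measurable)
      fix j :: nat
      have "(\<lambda>y. y (k, j)) \<in> PiM ({k} \<times> UNIV) (\<lambda>_. ?B) \<rightarrow>\<^sub>M ?B"
        by (rule measurable_component_singleton) simp
      then show "Measurable.pred (PiM ({k} \<times> UNIV) (\<lambda>_. ?B)) (\<lambda>y. y (k, j))"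
        by (simp cong: measurable_cong_sets)
    qed
  qed
  then show ?thesis by (simp add: field_def[abs_def])
qed

lemma distr_site_bits: "distr P coin_seq (\<lambda>w j. block_bit (bit_address k j) w) = coin_seq"
proof -
  let ?B = "measure_pmf (bernoulli_pmf (1 / 2))"
  have m: "block_bit l \<in> P \<rightarrow>\<^sub>M ?B" for l
    using block_bit_measurable[of l] by (simp add: measurable_def)
  \<comment> \<open>Since \<open>1 \<le> N\<close>, one site never carries a whole block, so all of
    its infinitely many bits are jointly independent.\<close>
  have ind: "P.indep_vars (\<lambda>_. ?B) (\<lambda>j. block_bit (bit_address k j)) UNIV"
    using proper_addresses[of "{k}"] N
    by (intro indep_block_bits) (auto simp: inj_on_def bit_address_inj image_iff)
  have one: "distr P ?B (block_bit (bit_address k j)) = ?B" for j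
  proof -
    let ?l = "bit_address k j"
    have "{i. (b, i) \<in> {?l}} \<subset> {..N}" for b
    proof (rule order_le_less_trans[OF _ proper_addresses[of "{k}"]])
      show "{i. (b, i) \<in> {?l}} \<subseteq> {i. \<exists>k\<in>{k}. \<exists>j. (b, i) = bit_address k j}" by blast
    qed (use N in simp_all)
    from prob_block_bits[OF _ this] have T: "P.prob {w. block_bit ?l w} = 1 / 2" by simp
    have F: "P.prob {w. \<not> block_bit ?l w} = 1 / 2"
    proof -
      have "{w. \<not> block_bit ?l w} = space P - {w. block_bit ?l w}" by auto
      moreover have "{w. block_bit ?l w} \<in> P.events" using block_bit_measurable[of ?l] by (simp add: pred_def)
      ultimately show ?thesis using P.prob_compl T by simp
    qed
    show ?thesis
    proof (rule measure_eqI_countable[where A=UNIV])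
      fix a :: bool
      have p: "P.prob {w. block_bit ?l w = a} = 1 / 2" using T F by (cases a) simp_all
      have "emeasure (distr P ?B (block_bit ?l)) {a} = emeasure P {w. block_bit ?l w = a}"
        by (subst emeasure_distr[OF m]) (auto simp: vimage_def)
      also have "\<dots> = ennreal (1 / 2)" by (simp only: P.emeasure_eq_measure p)
      also have "\<dots> = emeasure ?B {a}" by (cases a) (simp_all add: emeasure_pmf_single)
      finally show "emeasure (distr P ?B (block_bit ?l)) {a} = emeasure ?B {a}" .
    qed auto
  qed
  have "distr P (PiM UNIV (\<lambda>_. ?B)) (\<lambda>w. \<lambda>j\<in>UNIV. block_bit (bit_address k j) w) = PiM UNIV (\<lambda>j. distr P ?B (block_bit (bit_address k j)))"
    using ind by (subst (asm) P.indep_vars_iff_distr_eq_PiM) (auto intro: m)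
  then show ?thesis by (simp add: coin_seq_def one restrict_UNIV)
qed

lemma site_bits_measurable: "(\<lambda>w j. block_bit (bit_address k j) w) \<in> P \<rightarrow>\<^sub>M coin_seq"
proof -
  have "block_bit l \<in> P \<rightarrow>\<^sub>M measure_pmf (bernoulli_pmf (1 / 2))" for l
    using block_bit_measurable[of l] by (simp add: measurable_def)
  then show ?thesis unfolding coin_seq_def by (intro measurable_PiM_single') (auto simp: space_PiM)
qed

lemma distr_field: "distr P lborel (field k) = uniform_measure lborel {0..1}"
proof -
  have "field k = from_digits \<circ> (\<lambda>w j. block_bit (bit_address k j) w)" by (auto simp: field_def)
  then have "distr P lborel (field k) = distr (distr P coin_seq (\<lambda>w j. block_bit (bit_address k j) w)) lborel from_digits"
    using site_bits_measurable from_digits_measurable_coin_seq by (simp add: distr_distr)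
  then show ?thesis by (simp add: distr_site_bits distr_from_digits)
qed

text \<open>Recovery of coins from their sum, pulled back along the bits at \<open>k\<close>, whose
  law is \<open>coin_seq\<close>. It lets events about bits be expressed by the field up to null
  sets.\<close>

lemma AE_digit_field: "AE w in P. digit j (field k w) = block_bit (bit_address k j) w"
proof -
  have "AE b in distr P coin_seq (\<lambda>w j. block_bit (bit_address k j) w). \<forall>j. digit j (from_digits b) = b j"
    using AE_digit_from_digits by (simp only: distr_site_bits)
  from AE_distrD[OF site_bits_measurable this] show ?thesis
    by eventually_elim (simp add: field_def)
qed

section \<open>Translation invariance\<close>

lemma field_shift: "field (k + h) w = field k (\<lambda>b. w (fst b, snd b + h))"
  by (simp add: field_def block_bit_def bit_address_def algebra_simps)

text \<open>Translation permutes the blocks and preserves \<open>fst b\<close>, on which alone the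
  law of a block depends.\<close>

lemma distr_shift: "distr P P (\<lambda>w b. w (fst b, snd b + h)) = P"
proof -
  have "distr (PiM UNIV (\<lambda>b. measure_pmf (block b))) (PiM UNIV (\<lambda>b. measure_pmf (block (fst b, snd b + h))))
     (\<lambda>w. \<lambda>b\<in>UNIV. w (fst b, snd b + h)) = PiM UNIV (\<lambda>b. measure_pmf (block (fst b, snd b + h)))"
    by (rule distr_PiM_reindex) (auto simp: prob_space_measure_pmf inj_on_def prod_eq_iff)
  moreover have "block (fst b, snd b + h) = block b" for b by (simp add: block_def)
  ultimately show ?thesis by (simp add: P_def restrict_UNIV)
qed

lemma distr_field_shift:
  "distr P (PiM K (\<lambda>_. borel)) (\<lambda>w. \<lambda>k\<in>K. field (k + h) w) = distr P (PiM K (\<lambda>_. borel)) (\<lambda>w. \<lambda>k\<in>K. field k w)"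
proof -
  have sm: "(\<lambda>w b. w (fst b, snd b + h)) \<in> P \<rightarrow>\<^sub>M P"
    unfolding P_def
  proof (rule measurable_PiM_single')
    show "(\<lambda>w. w (fst b, snd b + h)) \<in> PiM UNIV (\<lambda>b. measure_pmf (block b)) \<rightarrow>\<^sub>M measure_pmf (block b)" for b
      using measurable_component_singleton[of "(fst b, snd b + h)" UNIV "\<lambda>b. measure_pmf (block b)"]
      by (simp add: block_def)
  qed auto
  have fm: "(\<lambda>w. \<lambda>k\<in>K. field k w) \<in> P \<rightarrow>\<^sub>M PiM K (\<lambda>_. borel)"
    by (rule measurable_restrict) simp
  have "distr P (PiM K (\<lambda>_. borel)) (\<lambda>w. \<lambda>k\<in>K. field k w) =
      distr (distr P P (\<lambda>w b. w (fst b, snd b + h))) (PiM K (\<lambda>_. borel)) (\<lambda>w. \<lambda>k\<in>K. field k w)"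
    by (simp only: distr_shift)
  also have "\<dots> = distr P (PiM K (\<lambda>_. borel)) (\<lambda>w. \<lambda>k\<in>K. field (k + h) w)"
    by (subst distr_distr[OF fm sm]) (simp add: comp_def field_shift)
  finally show ?thesis by simp
qed

section \<open>Correlation bound for separated sets\<close>

definition bits_in :: "(int ^ 'd) set \<Rightarrow> nat \<times> (int ^ 'd) \<Rightarrow> nat set \<Rightarrow> nat set" where
  "bits_in S b A = A \<inter> {i. i \<le> N \<and> site b i \<in> S}"

text \<open>Every digit summed in \<open>field k\<close> is one bit located at \<open>k\<close>,
  hence an event depending on one block through \<open>bits_in S\<close>. No exceptional null set
  arises in this direction.\<close>

lemma field_measurable_cylinder:
  assumes "k \<in> S"
  shows "field k \<in> borel_measurable (sigma UNIV (cylinder_events block (bits_in S)))"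
  unfolding field_def[abs_def]
proof (rule from_digits_measurable)
  fix j
  let ?l = "bit_address k j"
  have meas: "{w. block_bit ?l w} \<in> sets P" using block_bit_measurable[of ?l] by (simp add: pred_def)
  have bb: "block_bit ?l w \<longleftrightarrow> snd ?l \<in> bits_in S (fst ?l) (w (fst ?l))" for w
    using assms site_bit_address[of k j] bit_address_le[of k j]
    by (simp add: block_bit_def bits_in_def)
  have "{w. block_bit ?l w} \<in> cylinder_events block (bits_in S)"
    unfolding cylinder_events_def P_def[symmetric]
  proof (intro CollectI conjI exI[of _ "{fst ?l}"] allI impI meas)
    fix w w' assume "\<forall>b\<in>{fst ?l}. bits_in S b (w b) = bits_in S b (w' b)"
    then have "bits_in S (fst ?l) (w (fst ?l)) = bits_in S (fst ?l) (w' (fst ?l))" by simp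
    then show "w \<in> {w. block_bit ?l w} \<longleftrightarrow> w' \<in> {w. block_bit ?l w}"
      by (simp only: mem_Collect_eq bb)
  qed simp
  then have "{w \<in> space (sigma UNIV (cylinder_events block (bits_in S))). block_bit ?l w} \<in>
      sets (sigma UNIV (cylinder_events block (bits_in S)))"
    unfolding space_measure_of_conv by (simp add: sigma_sets.Basic)
  then show "Measurable.pred (sigma UNIV (cylinder_events block (bits_in S))) (\<lambda>w. block_bit ?l w)"
    by (simp only: pred_def)
qed

text \<open>If a block is covered by both sets, it has consecutive sites on opposite sides, at
  distance exactly \<open>Suc (fst b)\<close>. Separation then forces
  \<open>n \<le> Suc (fst b)\<close>, and monotonicity bounds the strength of the block by
  \<open>c n\<close>. Tensorisation combines the blocks.\<close>

lemma covar_le_cylinder_events: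
  assumes "1 \<le> n" and sep: "\<And>s t. s \<in> S \<Longrightarrow> t \<in> T \<Longrightarrow> real n \<le> zd_norm (s - t)"
    and "f \<in> borel_measurable (sigma UNIV (cylinder_events block (bits_in S)))"
    and "g \<in> borel_measurable (sigma UNIV (cylinder_events block (bits_in T)))"
    and "integrable P (\<lambda>w. (f w)\<^sup>2)" "integrable P (\<lambda>w. (g w)\<^sup>2)"
  shows "covar_le P (c n) f g"
  unfolding P_def
proof (rule covar_le_PiM)
  fix b and f g :: "nat set \<Rightarrow> real"
  assume f: "\<And>x y. bits_in S b x = bits_in S b y \<Longrightarrow> f x = f y"
    and g: "\<And>x y. bits_in T b x = bits_in T b y \<Longrightarrow> g x = g y"
  define A where "A = {i. i \<le> N \<and> site b i \<in> S}"
  define B where "B = {i. i \<le> N \<and> site b i \<in> T}"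
  have disj: "S \<inter> T = {}"
  proof -
    have "s \<notin> T" if "s \<in> S" for s
    proof
      assume "s \<in> T"
      from sep[OF that this] \<open>1 \<le> n\<close> show False by (simp add: zd_norm_def)
    qed
    then show ?thesis by blast
  qed
  show "covar_le (measure_pmf (block b)) (c n) f g"
    unfolding block_def
  proof (rule covar_le_block[where S=A and T=B])
    show "A \<inter> B = {}" using disj by (auto simp: A_def B_def)
    assume "A \<noteq> {}" "B \<noteq> {}" "A \<union> B = {..N}"
    from exists_adjacent_split[OF this(3,1,2) \<open>A \<inter> B = {}\<close>] obtain i
      where "i \<in> A \<and> Suc i \<in> B \<or> i \<in> B \<and> Suc i \<in> A" by blast
    then have "real n \<le> zd_norm (site b (Suc i) - site b i)"
      using sep[of "site b i" "site b (Suc i)"] sep[of "site b (Suc i)" "site b i"]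
        zd_norm_minus[of "site b (Suc i) - site b i"]
      by (auto simp: A_def B_def)
    also have "site b (Suc i) - site b i = axis u0 (int (Suc (fst b)))"
      by (simp add: site_def vec_eq_iff axis_def algebra_simps)
    finally have "n \<le> Suc (fst b)" by (simp add: zd_norm_axis)
    then show "c (Suc (fst b)) \<le> c n" using \<open>1 \<le> n\<close> by (intro c_mono)
  next
    show "f x = f y" if "x \<inter> A = y \<inter> A" for x y
      using that by (intro f) (simp add: bits_in_def A_def)
    show "g x = g y" if "x \<inter> B = y \<inter> B" for x y
      using that by (intro g) (simp add: bits_in_def B_def)
    show "0 \<le> c n" using c_range[OF \<open>1 \<le> n\<close>] by simp
    show "A \<subseteq> {..N}" "B \<subseteq> {..N}" by (auto simp: A_def B_def)
    show "finite {..N}" "{..N} \<noteq> {}" "0 \<le> c (Suc (fst b))" "c (Suc (fst b)) \<le> 1"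
      by (auto simp: c_Suc)
  qed
qed (use assms(3-6) in \<open>simp_all add: P_def\<close>)

lemma prob_block: "P.prob {w. w b \<in> A} = measure_pmf.prob (block b) A"
proof -
  have "distr P (measure_pmf (block b)) (\<lambda>w. w b) = measure_pmf (block b)"
    unfolding P_def
  proof -
    interpret PP: product_prob_space "\<lambda>b. measure_pmf (block b)" UNIV ..
    show "distr (PiM UNIV (\<lambda>b. measure_pmf (block b))) (measure_pmf (block b)) (\<lambda>w. w b) = measure_pmf (block b)"
      by (rule PP.PiM_component) simp
  qed
  moreover have "(\<lambda>w. w b) \<in> P \<rightarrow>\<^sub>M measure_pmf (block b)"
    unfolding P_def by (rule measurable_component_singleton) simp
  ultimately have "measure_pmf.prob (block b) A = P.prob ((\<lambda>w. w b) -` A \<inter> space P)"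
    by (metis measure_distr sets_measure_pmf UNIV_I)
  then show ?thesis by (simp add: vimage_def)
qed

end

subsection \<open>Law and mixing coefficients of the field\<close>

context block_field
begin

text \<open>The law of the field serves as canonical probability space on real configurations, with
  the coordinates as random variables; this is the sample space named in the theorem.\<close>

definition field_law :: "(int ^ 'd \<Rightarrow> real) measure" where
  "field_law = distr P (PiM UNIV (\<lambda>_. borel)) (\<lambda>w k. field k w)"

abbreviation (input) coord :: "int ^ 'd \<Rightarrow> (int ^ 'd \<Rightarrow> real) \<Rightarrow> real" where
  "coord k x \<equiv> x k"

lemma fields_measurable: "(\<lambda>w k. field k w) \<in> P \<rightarrow>\<^sub>M PiM UNIV (\<lambda>_. borel)"
  by (rule measurable_PiM_single') (auto simp: space_PiM)

lemma space_field_law [simp]: "space field_law = UNIV"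
  by (auto simp: field_law_def space_PiM)

lemma sets_field_law [measurable_cong]: "sets field_law = sets (PiM UNIV (\<lambda>_. borel))"
  by (simp add: field_law_def)

lemma coord_measurable [measurable]: "coord k \<in> borel_measurable field_law"
  unfolding measurable_cong_sets[OF sets_field_law refl]
  by (rule measurable_component_singleton) simp

sublocale Q: prob_space field_law
  unfolding field_law_def by (rule P.prob_space_distr[OF fields_measurable])

lemma distr_coords:
  assumes "(\<lambda>x. h (\<lambda>k. x k)) \<in> PiM UNIV (\<lambda>_. borel) \<rightarrow>\<^sub>M N'"
  shows "distr field_law N' (\<lambda>x. h (\<lambda>k. x k)) = distr P N' (\<lambda>w. h (\<lambda>k. field k w))"
  unfolding field_law_def by (subst distr_distr[OF assms fields_measurable]) (simp add: comp_def)

lemma restrict_coords_measurable: "(\<lambda>x. \<lambda>k\<in>K. x (k + h)) \<in> PiM UNIV (\<lambda>_. borel) \<rightarrow>\<^sub>M PiM K (\<lambda>_. borel)"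
  by (intro measurable_restrict measurable_component_singleton) simp

lemma strictly_stationary_coord: "strictly_stationary field_law coord"
  unfolding strictly_stationary_def
proof (intro allI impI)
  fix h :: "int ^ 'd" and K :: "(int ^ 'd) set"
  show "distr field_law (PiM K (\<lambda>_. borel)) (\<lambda>x. \<lambda>k\<in>K. x (k + h)) = distr field_law (PiM K (\<lambda>_. borel)) (\<lambda>x. \<lambda>k\<in>K. x k)"
    using distr_coords[of "\<lambda>x. \<lambda>k\<in>K. x (k + h)", OF restrict_coords_measurable]
      distr_coords[of "\<lambda>x. \<lambda>k\<in>K. x k"] restrict_coords_measurable[of K 0] distr_field_shift[of K h]
    by simp
qed

lemma distr_coord: "distr field_law borel (coord k) = distr P borel (field k)"
  by (rule distr_coords[of "\<lambda>x. x k"]) (rule measurable_component_singleton, simp)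

lemma uniform_coord: "distr field_law lborel (coord k) = uniform_measure lborel {0..1}"
proof -
  have "(\<lambda>x. x k) \<in> PiM UNIV (\<lambda>_. borel) \<rightarrow>\<^sub>M (lborel :: real measure)"
    using measurable_component_singleton[of k UNIV "\<lambda>_. borel :: real measure"] by simp
  from distr_coords[of "\<lambda>x. x k", OF this] show ?thesis by (simp add: distr_field)
qed

lemma indep_coord:
  assumes K: "finite K" "card K \<le> N"
  shows "Q.indep_vars (\<lambda>_. borel) coord K"
proof (cases "K = {}")
  case True
  then show ?thesis by (simp add: Q.indep_vars_def2 Q.indep_sets_def)
next
  case False
  have "distr field_law (PiM K (\<lambda>_. borel)) (\<lambda>x. \<lambda>k\<in>K. x k) = distr P (PiM K (\<lambda>_. borel)) (\<lambda>w. \<lambda>k\<in>K. field k w)"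
    using distr_coords[of "\<lambda>x. \<lambda>k\<in>K. x k"] restrict_coords_measurable[of K 0] by simp
  also have "\<dots> = PiM K (\<lambda>k. distr P borel (field k))"
    using indep_field[OF K] P.indep_vars_iff_distr_eq_PiM[of K field "\<lambda>_. borel"] False by simp
  also have "\<dots> = PiM K (\<lambda>k. distr field_law borel (coord k))"
    by (simp add: distr_coord)
  finally show ?thesis
    using Q.indep_vars_iff_distr_eq_PiM[of K coord "\<lambda>_. borel"] False by simp
qed

lemma gen_sigma_coord:
  "sigma_algebra (space field_law) (gen_sigma field_law coord S)" "gen_sigma field_law coord S \<subseteq> sets field_law"
proof -
  show "sigma_algebra (space field_law) (gen_sigma field_law coord S)"
    unfolding gen_sigma_def by (rule sigma_algebra_sigma_sets) force
  have "coord k -` B \<inter> space field_law \<in> sets field_law" if "B \<in> sets borel" for k B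
    using coord_measurable that by (rule measurable_sets)
  then show "gen_sigma field_law coord S \<subseteq> sets field_law"
    unfolding gen_sigma_def by (intro sets.sigma_sets_subset) blast
qed

text \<open>Pulls functions of the coordinates in \<open>S\<close> back to the block space, where
  tensorisation applies.\<close>

lemma comp_measurable_cylinder:
  assumes "f \<in> borel_measurable (sigma (space field_law) (gen_sigma field_law coord S))"
  shows "(\<lambda>w. f (\<lambda>k. field k w)) \<in> borel_measurable (sigma UNIV (cylinder_events block (bits_in S)))"
proof (rule measurable_compose[OF _ assms])
  let ?C = "sigma UNIV (cylinder_events block (bits_in S))"
  let ?G = "\<Union>k\<in>S. {coord k -` B \<inter> space field_law | B. B \<in> sets borel}"
  have "gen_sigma field_law coord S \<subseteq> Pow (space field_law)" by simp
  then have sets_eq: "sets (sigma (space field_law) (gen_sigma field_law coord S)) = sigma_sets (space field_law) ?G"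
    using sigma_algebra.sigma_sets_eq[OF gen_sigma_coord(1)] by (simp add: gen_sigma_def)
  show "(\<lambda>w k. field k w) \<in> ?C \<rightarrow>\<^sub>M sigma (space field_law) (gen_sigma field_law coord S)"
  proof (rule measurable_sigma_sets[OF sets_eq])
    fix A assume "A \<in> ?G"
    then obtain k B where kB: "k \<in> S" "B \<in> sets borel" "A = coord k -` B" by auto
    have "(\<lambda>w k. field k w) -` A \<inter> space ?C = field k -` B \<inter> space ?C" using kB by auto
    also have "\<dots> \<in> sets ?C" using field_measurable_cylinder[OF kB(1)] kB(2) by (rule measurable_sets)
    finally show "(\<lambda>w k. field k w) -` A \<inter> space ?C \<in> sets ?C" .
  qed (auto simp: space_measure_of_conv)
qed

lemma covar_field_law:
  assumes "f \<in> borel_measurable field_law" "g \<in> borel_measurable field_law"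
  shows "covar field_law f g = covar P (\<lambda>w. f (\<lambda>k. field k w)) (\<lambda>w. g (\<lambda>k. field k w))"
proof -
  have *: "(\<integral>x. h x \<partial>field_law) = (\<integral>w. h (\<lambda>k. field k w) \<partial>P)" if "h \<in> borel_measurable field_law" for h :: "_ \<Rightarrow> real"
    using that unfolding measurable_cong_sets[OF sets_field_law refl]
    unfolding field_law_def by (rule integral_distr[OF fields_measurable])
  show ?thesis unfolding covar_def using assms by (subst (1 2 3) *) auto
qed

lemma covar_bounded_coord:
  assumes "1 \<le> n" and sep: "\<And>s t. s \<in> S \<Longrightarrow> t \<in> T \<Longrightarrow> real n \<le> zd_norm (s - t)"
  shows "covar_bounded field_law (gen_sigma field_law coord S) (gen_sigma field_law coord T) (c n)"
proof (rule covar_bounded.intro[OF Q.prob_space_axioms covar_bounded_axioms.intro])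
  fix f g :: "(int ^ 'd \<Rightarrow> real) \<Rightarrow> real"
  assume f: "f \<in> borel_measurable (sigma (space field_law) (gen_sigma field_law coord S))"
    and g: "g \<in> borel_measurable (sigma (space field_law) (gen_sigma field_law coord T))"
    and f2: "integrable field_law (\<lambda>x. (f x)\<^sup>2)" and g2: "integrable field_law (\<lambda>x. (g x)\<^sup>2)"
  have m: "h \<in> borel_measurable field_law"
    if "h \<in> borel_measurable (sigma (space field_law) (gen_sigma field_law coord R))" for h :: "_ \<Rightarrow> real" and R
    using measurable_mono[THEN subsetD, OF order_refl refl _ _ that, of field_law]
      sets.sigma_sets_subset[OF gen_sigma_coord(2)[of R]] by (simp add: space_measure_of_conv)
  have int: "integrable P (\<lambda>w. (h (\<lambda>k. field k w))\<^sup>2)" if "integrable field_law (\<lambda>x. (h x)\<^sup>2)" for h :: "_ \<Rightarrow> real"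
    using that unfolding field_law_def by (rule integrable_distr[OF fields_measurable])
  have "covar_le P (c n) (\<lambda>w. f (\<lambda>k. field k w)) (\<lambda>w. g (\<lambda>k. field k w))"
    using assms comp_measurable_cylinder[OF f] comp_measurable_cylinder[OF g] int[OF f2] int[OF g2]
    by (rule covar_le_cylinder_events)
  then show "covar_le field_law (c n) f g"
    unfolding covar_le_def using covar_field_law m[OF f] m[OF g] by simp
next
  show "0 \<le> c n" using c_range[OF assms(1)] by simp
qed (rule gen_sigma_coord)+

section \<open>Extremal events and values of the coefficients\<close>

lemma coord_pred_gen_sigma:
  assumes "k \<in> S" "Measurable.pred borel Q"
  shows "{x. Q (x k)} \<in> gen_sigma field_law coord S"
proof -
  have "{x. Q (x k)} = coord k -` {y. Q y} \<inter> space field_law" by auto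
  moreover have "{y. Q y} \<in> sets borel" using assms(2) by (simp add: pred_def)
  ultimately show ?thesis unfolding gen_sigma_def using assms(1) by (intro sigma_sets.Basic) blast
qed

text \<open>Witnesses: the event that one end bit of a block is set, and the event that its other bits have
  even parity.\<close>

lemma extremal_events:
  assumes n: "1 \<le> n"
  defines "S \<equiv> {k. k $ u0 \<le> 0}" and "T \<equiv> {k. k $ u0 \<ge> 0 + int n}"
  obtains A B where "A \<in> gen_sigma field_law coord S" "B \<in> gen_sigma field_law coord T"
    "Q.prob A = 1 / 2" "Q.prob B = 1 / 2" "Q.prob (A \<inter> B) = (1 - c n) / 4"
proof -
  obtain m where m: "n = Suc m" using n by (cases n) auto
  \<comment> \<open>The sites of the block \<open>b\<close> of step \<open>n\<close> starting at the
    origin. The first lies in \<open>S\<close>; the others have coordinate at least \<open>n\<close>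
    and lie in \<open>T\<close>.\<close>
  define x0 where "x0 i = (axis u0 (int (i * n)) :: int ^ 'd)" for i
  define b :: "nat \<times> (int ^ 'd)" where "b = (m, 0)"
  define D where "D i x \<longleftrightarrow> digit (m * Suc N + i) (coord (x0 i) x)" for i x
  define A where "A = {x. D 0 x}"
  define B where "B = {x. parity {i \<in> {1..N}. D i x} = 1}"
  have addr: "bit_address (x0 i) (m * Suc N + i) = (b, i)" if "i \<le> N" for i
    using bit_address_mult_add[OF that, of "x0 i" m] by (simp add: x0_def b_def m del: mult_Suc_right)
  have AE: "AE w in P. \<forall>i\<in>{..N}. D i (\<lambda>k. field k w) \<longleftrightarrow> i \<in> w b"
  proof (rule AE_finite_allI)
    fix i assume "i \<in> {..N}"
    then show "AE w in P. D i (\<lambda>k. field k w) \<longleftrightarrow> i \<in> w b"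
      using AE_digit_field[of "m * Suc N + i" "x0 i"] addr[of i] by (simp add: D_def block_bit_def)
  qed simp
  have DS: "{x. D i x} \<in> gen_sigma field_law coord R" if "x0 i \<in> R" for i R
    unfolding D_def by (rule coord_pred_gen_sigma[OF that]) simp
  have A: "A \<in> gen_sigma field_law coord S"
    unfolding A_def by (rule DS) (simp add: S_def x0_def axis_def)
  have B: "B \<in> gen_sigma field_law coord T"
  proof -
    interpret G: sigma_algebra "space field_law" "gen_sigma field_law coord T" by (rule gen_sigma_coord)
    have D: "{x. D i x} \<in> gen_sigma field_law coord T" if "1 \<le> i" for i
    proof (rule DS)
      have "1 * n \<le> i * n" using that by (rule mult_le_mono1)
      then have "int n \<le> int (i * n)" by (simp only: mult_1 of_nat_le_iff)
      then show "x0 i \<in> T" by (simp add: T_def x0_def axis_def)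
    qed
    have D': "(if i \<in> I then {x. D i x} else space field_law - {x. D i x}) \<in> gen_sigma field_law coord T"
      if "1 \<le> i" for i I using D[OF that] G.compl_sets by simp
    \<comment> \<open>The parity event is a finite union over the even bit patterns
      \<open>I\<close>, each given by finitely many digits or their complements.\<close>
    have "B = (\<Union>I\<in>{I \<in> Pow {1..N}. parity I = 1}. \<Inter>i\<in>{1..N}. if i \<in> I then {x. D i x} else space field_law - {x. D i x})"
      (is "_ = ?R")
    proof (intro equalityI subsetI)
      fix x assume "x \<in> B"
      then show "x \<in> ?R" by (intro UN_I[of "{i \<in> {1..N}. D i x}"]) (auto simp: B_def)
    next
      fix x assume "x \<in> ?R"
      then obtain I where I: "I \<subseteq> {1..N}" "parity I = 1"
        and x: "\<And>i. i \<in> {1..N} \<Longrightarrow> x \<in> (if i \<in> I then {x. D i x} else space field_law - {x. D i x})" by blast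
      have "D i x \<longleftrightarrow> i \<in> I" if "i \<in> {1..N}" for i using x[OF that] by (auto split: if_splits)
      then have "{i \<in> {1..N}. D i x} = I" using I(1) by auto
      then show "x \<in> B" using I(2) by (simp add: B_def)
    qed
    also have "\<dots> \<in> gen_sigma field_law coord T"
      using D' N by (intro G.finite_UN G.finite_INT) auto
    finally show ?thesis .
  qed
  \<comment> \<open>Transfer principle: an event about the digits \<open>D i\<close> has the
    probability of the corresponding event about the bits of \<open>b\<close>, because both agree
    almost surely.\<close>
  have prob: "Q.prob C = measure_pmf.prob (block b) C'"
    if C: "C \<in> Q.events" and eq: "\<And>x I. (\<And>i. i \<in> {..N} \<Longrightarrow> D i x \<longleftrightarrow> i \<in> I) \<Longrightarrow> x \<in> C \<longleftrightarrow> I \<in> C'" for C C'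
  proof -
    have mC: "(\<lambda>w k. field k w) -` C \<inter> space P \<in> P.events"
      using C unfolding sets_field_law by (rule measurable_sets[OF fields_measurable])
    have mC': "{w. w b \<in> C'} \<in> P.events"
    proof -
      have "(\<lambda>w. w b) \<in> P \<rightarrow>\<^sub>M measure_pmf (block b)"
        unfolding P_def by (rule measurable_component_singleton) simp
      from measurable_sets[OF this, of C'] show ?thesis by (simp add: vimage_def)
    qed
    have "Q.prob C = P.prob ((\<lambda>w k. field k w) -` C \<inter> space P)"
      unfolding field_law_def using C unfolding sets_field_law by (rule measure_distr[OF fields_measurable])
    also have "\<dots> = P.prob {w. w b \<in> C'}"
    proof (rule P.finite_measure_eq_AE[OF _ mC mC'])
      show "AE w in P. w \<in> (\<lambda>w k. field k w) -` C \<inter> space P \<longleftrightarrow> w \<in> {w. w b \<in> C'}"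
        using AE
      proof eventually_elim
        case (elim w)
        then show ?case using eq[of "\<lambda>k. field k w" "w b"] by simp
      qed
    qed
    also have "\<dots> = measure_pmf.prob (block b) C'" by (rule prob_block)
    finally show ?thesis .
  qed
  have blk: "block b = block_pmf {..N} (c n)" by (simp add: block_def b_def m)
  have split: "{0} \<inter> {1..N} = {}" "{0} \<union> {1..N} = {..N}" "{0::nat} \<noteq> {}" "{1..N} \<noteq> {}" using N by auto
  have cn: "0 \<le> c n" "c n \<le> 1" using c_range[OF n] by auto
  note pb = prob_block_parity[OF finite_atMost _ cn split]
  have ev: "A \<in> Q.events" "B \<in> Q.events" using A B gen_sigma_coord(2) by blast+
  have par: "parity (I \<inter> {0}) = -1 \<longleftrightarrow> 0 \<in> I" for I
    by (cases "0 \<in> I") (simp_all add: parity_def)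
  have eqA: "x \<in> A \<longleftrightarrow> I \<in> {A. parity (A \<inter> {0}) = -1}" and eqB: "x \<in> B \<longleftrightarrow> I \<in> {A. parity (A \<inter> {1..N}) = 1}"
    if "\<And>i. i \<in> {..N} \<Longrightarrow> D i x \<longleftrightarrow> i \<in> I" for x I
  proof -
    show "x \<in> A \<longleftrightarrow> I \<in> {A. parity (A \<inter> {0}) = -1}" using that[of 0] by (simp add: A_def par)
    have "{i \<in> {1..N}. D i x} = I \<inter> {1..N}" using that by auto
    then show "x \<in> B \<longleftrightarrow> I \<in> {A. parity (A \<inter> {1..N}) = 1}" by (simp add: B_def)
  qed
  show thesis
  proof (rule that[OF A B])
    show "Q.prob A = 1 / 2" using prob[OF ev(1) eqA] pb(1) by (simp add: blk)
    show "Q.prob B = 1 / 2" using prob[OF ev(2) eqB] pb(2) by (simp add: blk)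
    have "Q.prob (A \<inter> B) = measure_pmf.prob (block b) ({A. parity (A \<inter> {0}) = -1} \<inter> {A. parity (A \<inter> {1..N}) = 1})"
      using ev eqA eqB by (intro prob) blast+
    then show "Q.prob (A \<inter> B) = (1 - c n) / 4" using pb(3) by (simp add: blk)
  qed
qed

lemma half_space_sep:
  assumes "(s :: int ^ 'd) $ u \<le> j" "j + int n \<le> t $ u"
  shows "real n \<le> zd_norm (s - t)"
proof -
  have "real n \<le> \<bar>of_int ((s - t) $ u)\<bar>" using assms by simp
  also have "\<dots> \<le> zd_norm (s - t)" by (rule abs_component_le_zd_norm)
  finally show ?thesis .
qed

text \<open>The witnesses have covariance \<open>- (c n / 4)\<close> and probability 1/2 each, which
  meets the upper bounds for both coefficients exactly.\<close>

lemma extremal_coefs: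
  assumes n: "1 \<le> n"
  defines "S \<equiv> {k. k $ u0 \<le> 0}" and "T \<equiv> {k. k $ u0 \<ge> 0 + int n}"
  shows "alpha_coef field_law (gen_sigma field_law coord S) (gen_sigma field_law coord T) = c n / 4"
    and "rho_coef field_law (gen_sigma field_law coord S) (gen_sigma field_law coord T) = c n"
proof -
  interpret covar_bounded field_law "gen_sigma field_law coord S" "gen_sigma field_law coord T" "c n"
    using half_space_sep[of _ u0 0 n] unfolding S_def T_def by (intro covar_bounded_coord[OF n]) blast
  obtain A B where AB: "A \<in> gen_sigma field_law coord S" "B \<in> gen_sigma field_law coord T"
    "Q.prob A = 1 / 2" "Q.prob B = 1 / 2" "Q.prob (A \<inter> B) = (1 - c n) / 4"
    using extremal_events[OF n] unfolding S_def T_def by blast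
  have "Q.prob (A \<inter> B) - Q.prob A * Q.prob B = - (c n / 4)" unfolding AB(3-5) by (simp add: field_simps)
  then have 1: "\<bar>Q.prob (A \<inter> B) - Q.prob A * Q.prob B\<bar> = c n / 4" using r by simp
  show "alpha_coef field_law (gen_sigma field_law coord S) (gen_sigma field_law coord T) = c n / 4"
    using alpha_coef_le alpha_coef_ge[OF AB(1,2)] 1 by linarith
  show "rho_coef field_law (gen_sigma field_law coord S) (gen_sigma field_law coord T) = c n"
    using rho_coef_le rho_coef_ge_events[OF AB(1-4), unfolded 1] by simp
qed

text \<open>Each supremum is a maximum: every admissible pair is separated by \<open>n\<close> in
  norm and so bounded, and the pair of half-spaces orthogonal to \<open>u0\<close> is admissible in
  all four families. For \<rho>' it arises from \<open>{..0}\<close> and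
  \<open>{int n..}\<close>.\<close>

lemma field_coefs:
  assumes n: "1 \<le> n"
  shows "4 * alpha_field field_law coord n = c n" "rho_field field_law coord n = c n"
    "rho'_field field_law coord n = c n" "rho_star_field field_law coord n = c n"
proof -
  have half: "covar_bounded field_law (gen_sigma field_law coord {k. k $ u \<le> j})
      (gen_sigma field_law coord {k. k $ u \<ge> j + int n}) (c n)" for u j
    using half_space_sep[of _ u j n] by (intro covar_bounded_coord[OF n]) blast
  have "alpha_field field_law coord n = c n / 4"
    unfolding alpha_field_def
  proof (rule cSup_eq_maximum)
    show "c n / 4 \<in> {alpha_coef field_law (gen_sigma field_law coord {k. k $ u \<le> j})
        (gen_sigma field_law coord {k. k $ u \<ge> j + int n}) | j u. True}"
      using extremal_coefs(1)[OF n] by (intro CollectI exI[of _ 0] exI[of _ u0]) simp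
  next
    fix x
    assume "x \<in> {alpha_coef field_law (gen_sigma field_law coord {k. k $ u \<le> j})
        (gen_sigma field_law coord {k. k $ u \<ge> j + int n}) | j u. True}"
    then obtain j u where "x = alpha_coef field_law (gen_sigma field_law coord {k. k $ u \<le> j})
        (gen_sigma field_law coord {k. k $ u \<ge> j + int n})" by blast
    then show "x \<le> c n / 4" using covar_bounded.alpha_coef_le[OF half[of u j]] by simp
  qed
  then show "4 * alpha_field field_law coord n = c n" by simp
  show "rho_field field_law coord n = c n"
    unfolding rho_field_def
  proof (rule cSup_eq_maximum)
    show "c n \<in> {rho_coef field_law (gen_sigma field_law coord {k. k $ u \<le> j})
        (gen_sigma field_law coord {k. k $ u \<ge> j + int n}) | j u. True}"
      using extremal_coefs(2)[OF n] by (intro CollectI exI[of _ 0] exI[of _ u0]) simp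
  qed (use covar_bounded.rho_coef_le[OF half] in blast)
  show "rho'_field field_law coord n = c n"
    unfolding rho'_field_def
  proof (rule cSup_eq_maximum)
    show "c n \<in> {rho_coef field_law (gen_sigma field_law coord {k. k $ u \<in> G}) (gen_sigma field_law coord {k. k $ u \<in> H})
          | u G H. G \<noteq> {} \<and> H \<noteq> {} \<and> G \<inter> H = {} \<and> (\<forall>g\<in>G. \<forall>h\<in>H. int n \<le> \<bar>g - h\<bar>)}"
      using extremal_coefs(2)[OF n] n
      by (intro CollectI exI[of _ u0] exI[of _ "{..0}"] exI[of _ "{int n..}"]) auto
  next
    fix x
    assume "x \<in> {rho_coef field_law (gen_sigma field_law coord {k. k $ u \<in> G}) (gen_sigma field_law coord {k. k $ u \<in> H})
          | u G H. G \<noteq> {} \<and> H \<noteq> {} \<and> G \<inter> H = {} \<and> (\<forall>g\<in>G. \<forall>h\<in>H. int n \<le> \<bar>g - h\<bar>)}"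
    then obtain u G H where x: "x = rho_coef field_law (gen_sigma field_law coord {k. k $ u \<in> G}) (gen_sigma field_law coord {k. k $ u \<in> H})"
      and sep: "\<And>g h. g \<in> G \<Longrightarrow> h \<in> H \<Longrightarrow> int n \<le> \<bar>g - h\<bar>" by blast
    have "covar_bounded field_law (gen_sigma field_law coord {k. k $ u \<in> G}) (gen_sigma field_law coord {k. k $ u \<in> H}) (c n)"
    proof (rule covar_bounded_coord[OF n])
      fix s t assume "s \<in> {k. k $ u \<in> G}" "t \<in> {k. k $ u \<in> H}"
      then have "int n \<le> \<bar>(s - t) $ u\<bar>" using sep by simp
      then have "real n \<le> \<bar>of_int ((s - t) $ u)\<bar>" by linarith
      also have "\<dots> \<le> zd_norm (s - t)" by (rule abs_component_le_zd_norm)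
      finally show "real n \<le> zd_norm (s - t)" .
    qed
    then show "x \<le> c n" unfolding x by (rule covar_bounded.rho_coef_le)
  qed
  show "rho_star_field field_law coord n = c n"
    unfolding rho_star_field_def
  proof (rule cSup_eq_maximum)
    let ?S = "{k. k $ u0 \<le> 0} :: (int ^ 'd) set" and ?T = "{k. k $ u0 \<ge> 0 + int n} :: (int ^ 'd) set"
    have ne: "0 \<in> ?S" "axis u0 (int n) \<in> ?T" by (simp_all add: axis_def)
    show "c n \<in> {rho_coef field_law (gen_sigma field_law coord S) (gen_sigma field_law coord T)
          | S T. S \<noteq> {} \<and> T \<noteq> {} \<and> S \<inter> T = {} \<and> (\<forall>s\<in>S. \<forall>t\<in>T. real n \<le> zd_norm (s - t))}"
    proof (rule CollectI, rule exI[of _ ?S], rule exI[of _ ?T], intro conjI ballI)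
      show "c n = rho_coef field_law (gen_sigma field_law coord ?S) (gen_sigma field_law coord ?T)"
        by (rule extremal_coefs(2)[OF n, symmetric])
      show "?S \<noteq> {}" "?T \<noteq> {}" using ne by blast+
      show "?S \<inter> ?T = {}" using n by auto
      show "real n \<le> zd_norm (s - t)" if "s \<in> ?S" "t \<in> ?T" for s t
        using that half_space_sep[of s u0 0 n t] by simp
    qed
  next
    fix x
    assume "x \<in> {rho_coef field_law (gen_sigma field_law coord S) (gen_sigma field_law coord T)
          | S T. S \<noteq> {} \<and> T \<noteq> {} \<and> S \<inter> T = {} \<and> (\<forall>s\<in>S. \<forall>t\<in>T. real n \<le> zd_norm (s - t))}"
    then obtain S T where x: "x = rho_coef field_law (gen_sigma field_law coord S) (gen_sigma field_law coord T)"
      and sep: "\<And>s t. s \<in> S \<Longrightarrow> t \<in> T \<Longrightarrow> real n \<le> zd_norm (s - t)" by blast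
    show "x \<le> c n" unfolding x by (rule covar_bounded.rho_coef_le[OF covar_bounded_coord[OF n sep]])
  qed
qed

end

theorem theorem1p4:
  fixes N :: nat and c :: "nat \<Rightarrow> real"
  assumes "N \<ge> 2"
    and "\<And>n. n \<ge> 1 \<Longrightarrow> c n \<in> {0..1}"
    and "\<And>n. n \<ge> 1 \<Longrightarrow> c (Suc n) \<le> c n"
  shows "\<exists>(M :: (int ^ 'd::finite \<Rightarrow> real) measure) (X :: int ^ 'd \<Rightarrow> (int ^ 'd \<Rightarrow> real) \<Rightarrow> real).
           prob_space M \<and> (\<forall>k. X k \<in> borel_measurable M) \<and>
           strictly_stationary M X \<and>
           distr M lborel (X 0) = uniform_measure lborel {0..1} \<and>
           tuplewise_indep M N X \<and>
           (\<forall>n\<ge>1. 4 * alpha_field M X n = c n \<and> rho_field M X n = c n \<and>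
                   rho'_field M X n = c n \<and> rho_star_field M X n = c n)"
proof -
  \<comment> \<open>Any coordinate direction can carry the lines of the blocks;
    \<open>undefined\<close> picks one.\<close>
  interpret block_field N c "undefined :: 'd"
  proof
    show "c m \<le> c n" if "1 \<le> n" "n \<le> m" for m n
      using that(2)
    proof (induction rule: dec_induct)
      case (step m)
      have "c (Suc m) \<le> c m" using that(1) step(1) by (intro assms(3)) simp
      with step.IH show ?case by simp
    qed simp
    show "1 \<le> N" using assms(1) by simp
  qed (rule assms(2))
  have "tuplewise_indep field_law N (\<lambda>k x. coord k x)"
    unfolding tuplewise_indep_def using indep_coord by simp
  then show ?thesis
    using Q.prob_space_axioms coord_measurable strictly_stationary_coord uniform_coord field_coefs
    by (intro exI[of _ field_law] exI[of _ "\<lambda>k x. coord k x"] conjI allI impI) simp_all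
qed

end
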